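(* Let $\gamma\in \mathcal{C}(T)$ be an essential curve on the once-punctured torus $T$. (1) Every $\alpha\in \mathrm{Mod}(T)\cdot \gamma$ satisfies $S^k\alpha\in T_\gamma\cup T_{S(\gamma)}$ for some $k\in\{0,1,2,3\}$. (2) Assume that $\gamma$ is in standard position and has minimal length in its orbit $\mathrm{Mod}(T)\cdot\gamma$. Then for all integers $n > \ell(\gamma)$, \[ \#\{\alpha\in\mathrm{Mod}(T)\cdot \gamma\mid \ell(\alpha)=n\}=m\cdot \# \{ \alpha \in T_\gamma\cup T_{S(\gamma)} \mid \ell(\alpha) = n \}, \] where $m=2$ if $\mathrm{Stab}_{\mathrm{Mod}(T)}(\gamma)$ has some non-trivial torsion element, and $m=4$ otherwise. (Here $T_\gamma\cup T_{S(\gamma)}$ is regarded as a set of curves.)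
   Context: $T$ is a once-punctured topological torus. A curve is a free homotopy class of an unoriented closed curve on $T$; $\mathcal{C}(T)$ is the set of curves. $\pi_1(T)$ is free of rank $2$ on $\mathtt{a},\mathtt{b}$ (the puncture loop being represented by the commutator of $\mathtt a$ and $\mathtt b$), $\mathtt{A}=\mathtt{a}^{-1}$, $\mathtt{B}=\mathtt{b}^{-1}$, and $\mathcal{C}(T)$ is in bijection with conjugacy classes of $\pi_1(T)$ up to inversion. A curve is essential if it is neither null-homotopic nor a power of a loop around the puncture. $\ell(\gamma)$ is the number of letters of a cyclically reduced word in $\{\mathtt{a},\mathtt{b},\mathtt{A},\mathtt{B}\}$ representing $\gamma$. $\mathrm{Mod}(T)$ is the group of isotopy classes of orientation-preserving self-homeomorphisms of $T$; it is identified with $\mathrm{SL}_2(\mathbb{Z})$ (columns of the matrix being the abelianized images of $\mathtt a$ and $\mathtt b$), with generators $L:\mathtt{a}\mapsto\mathtt{a},\mathtt{b}\mapsto\mathtt{ab}$, i.e. $L=\begin{pmatrix}1&1\\0&1\end{pmatrix}$, and $R:\mathtt{a}\mapsto\mathtt{ab},\mathtt{b}\mapsto\mathtt{b}$, i.e. $R=\begin{pmatrix}1&0\\1&1\end{pmatrix}$. Put $S=\begin{pmatrix}0&-1\\1&0\end{pmatrix}$ (acting as the renaming of letters $\mathtt a\mapsto \mathtt b$, $\mathtt b\mapsto\mathtt A$) and $U=\begin{pmatrix}0&-1\\1&-1\end{pmatrix}$. $\langle L,R\rangle_+$ is the free monoid of positive products of $L$ and $R$ (including the identity $I$). For a curve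 $\gamma$, $T_\gamma:=\langle L,R\rangle_+\cdot\gamma$ and $T_{S(\gamma)}:=\langle L,R\rangle_+\cdot S(\gamma)$. A curve $\gamma$ is in standard position if $\mathrm{Stab}_{\mathrm{Mod}(T)}(\gamma)$ is one of the subgroups $\{I\}, \langle -I \rangle, \langle U\rangle, \langle S \rangle, \langle -U\rangle, \langle L\rangle, \langle -L\rangle, \langle -I, L\rangle$. *)

theory Defs
  imports "HOL-Analysis.Determinants" "HOL-Algebra.Generated_Groups"
begin

section \<open>The free group on two generators\<close>

text \<open>
  The letters \<open>La\<close>, \<open>Lb\<close> are the generators; \<open>LA\<close>, \<open>LB\<close> are their formal inverses.
\<close>

datatype letter = La | Lb | LA | LB

fun linv :: "letter \<Rightarrow> letter" where
  "linv La = LA"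
| "linv LA = La"
| "linv Lb = LB"
| "linv LB = Lb"

type_synonym word = "letter list"

definition reduced :: "word \<Rightarrow> bool" where
  "reduced w \<longleftrightarrow> successively (\<lambda>x y. y \<noteq> linv x) w"

definition cyclically_reduced :: "word \<Rightarrow> bool" where
  "cyclically_reduced w \<longleftrightarrow> reduced w \<and> (w \<noteq> [] \<longrightarrow> hd w \<noteq> linv (last w))"

fun lcons :: "letter \<Rightarrow> word \<Rightarrow> word" where
  "lcons x [] = [x]"
| "lcons x (y # w) = (if y = linv x then w else x # y # w)"

text \<open>
  For reduced \<open>u\<close> and \<open>v\<close>, \<open>foldr lcons u v\<close> is the reduced form of the concatenation \<open>u @ v\<close>.
\<close>

definition F2 :: "word monoid" where
  "F2 = \<lparr>carrier = {w. reduced w}, mult = (\<lambda>u v. foldr lcons u v), one = []\<rparr>"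

lemma F2_simps [simp]:
  "carrier F2 = {w. reduced w}"
  "u \<otimes>\<^bsub>F2\<^esub> v = foldr lcons u v"
  "\<one>\<^bsub>F2\<^esub> = []"
  by (simp_all add: F2_def)

lemma linv_linv [simp]: "linv (linv x) = x"
  by (cases x) auto

lemma reduced_Nil [simp]: "reduced []"
  by (simp add: reduced_def)

lemma reduced_Cons:
  "reduced (x # w) \<longleftrightarrow> reduced w \<and> (w \<noteq> [] \<longrightarrow> hd w \<noteq> linv x)"
  by (cases w) (auto simp: reduced_def)

lemma reduced_lcons: "reduced w \<Longrightarrow> reduced (lcons x w)"
  by (cases w) (auto simp: reduced_Cons)

lemma lcons_reduced: "reduced (x # w) \<Longrightarrow> lcons x w = x # w"
  by (cases w) (auto simp: reduced_Cons)

lemma lcons_cancel: "reduced w \<Longrightarrow> lcons x (lcons (linv x) w) = w"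
  by (cases w rule: list.exhaust; cases "tl w") (auto simp: reduced_Cons)

lemma reduced_foldr_lcons: "reduced v \<Longrightarrow> reduced (foldr lcons u v)"
  by (induction u) (auto simp: reduced_lcons)

lemma foldr_lcons_lcons:
  assumes "reduced u" "reduced w"
  shows "foldr lcons (lcons x u) w = lcons x (foldr lcons u w)"
proof (cases u)
  case (Cons y u')
  then show ?thesis
    using assms lcons_cancel[of "foldr lcons u' w" x] reduced_foldr_lcons[of w u'] by auto
qed simp

lemma foldr_lcons_assoc:
  assumes "reduced v" "reduced w"
  shows "foldr lcons (foldr lcons u v) w = foldr lcons u (foldr lcons v w)"
  using assms by (induction u) (auto simp: foldr_lcons_lcons reduced_foldr_lcons)

lemma foldr_lcons_Nil: "reduced u \<Longrightarrow> foldr lcons u [] = u"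
  by (induction u) (auto simp: lcons_reduced reduced_Cons)

lemma lcons_left_inverse: "\<exists>u. reduced u \<and> foldr lcons u w = []" if "reduced w" for w
  using that
proof (induction w)
  case (Cons x w)
  then obtain u where u: "reduced u" "foldr lcons u w = []"
    by (auto simp: reduced_Cons)
  let ?u = "foldr lcons u [linv x]"
  have r: "reduced [linv x]"
    by (simp add: reduced_def)
  have "foldr lcons ?u (x # w) = foldr lcons u w"
    using foldr_lcons_assoc[OF r Cons.prems, of u] by simp
  then show ?case
    using u reduced_foldr_lcons[OF r, of u] by metis
qed (auto intro: exI[of _ "[]"])

lemma group_F2: "group F2"
proof (rule groupI)
  fix x assume "x \<in> carrier F2"
  then show "\<exists>y\<in>carrier F2. y \<otimes>\<^bsub>F2\<^esub> x = \<one>\<^bsub>F2\<^esub>"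
    using lcons_left_inverse[of x] by auto
qed (auto simp: reduced_foldr_lcons foldr_lcons_assoc)

section \<open>Curves\<close>

text \<open>
  The fundamental group of the once-punctured torus is \<open>F2\<close>, and free homotopy classes of
  unoriented closed curves are conjugacy classes up to inversion.  A curve is represented by
  that set of group elements.
\<close>

type_synonym curve = "word set"

definition curve_of :: "word \<Rightarrow> curve" where
  "curve_of w = {g \<otimes>\<^bsub>F2\<^esub> v \<otimes>\<^bsub>F2\<^esub> inv\<^bsub>F2\<^esub> g | g v. g \<in> carrier F2 \<and> v \<in> {w, inv\<^bsub>F2\<^esub> w}}"

definition curves :: "curve set" where
  "curves = curve_of ` carrier F2"

definition puncture :: word where
  "puncture = [La, Lb, LA, LB]"

text \<open>The exponent \<open>k = 0\<close> is the null-homotopic curve.\<close>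

definition essential :: "curve \<Rightarrow> bool" where
  "essential \<gamma> \<longleftrightarrow> \<gamma> \<in> curves \<and> (\<forall>k::int. \<gamma> \<noteq> curve_of (puncture [^]\<^bsub>F2\<^esub> k))"

text \<open>
  All cyclically reduced words representing a given curve have the same number of letters.
\<close>

definition curve_length :: "curve \<Rightarrow> nat" where
  "curve_length \<gamma> = (THE n. \<exists>w\<in>\<gamma>. cyclically_reduced w \<and> length w = n)"

section \<open>The mapping class group\<close>

definition SL2Z :: "(int^2^2) monoid" where
  "SL2Z = \<lparr>carrier = {M. det M = 1}, mult = (\<lambda>M N. M ** N), one = mat 1\<rparr>"

lemma SL2Z_simps [simp]:
  "carrier SL2Z = {M. det M = 1}"
  "M \<otimes>\<^bsub>SL2Z\<^esub> N = M ** N"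
  "\<one>\<^bsub>SL2Z\<^esub> = mat 1"
  by (simp_all add: SL2Z_def)

lemma group_SL2Z: "group SL2Z"
proof (rule groupI)
  fix M assume M: "M \<in> carrier SL2Z"
  define N :: "int^2^2" where "N = vector [vector [M$2$2, - M$1$2], vector [- M$2$1, M$1$1]]"
  have "N ** M = mat 1" "det N = 1"
    using M by (auto simp: N_def vec_eq_iff forall_2 matrix_matrix_mult_def sum_2 mat_def det_2
        algebra_simps)
  then show "\<exists>N\<in>carrier SL2Z. N \<otimes>\<^bsub>SL2Z\<^esub> M = \<one>\<^bsub>SL2Z\<^esub>"
    by auto
qed (auto simp: det_mul matrix_mul_assoc)

definition matI :: "int^2^2" where "matI = mat 1"
definition matL :: "int^2^2" where "matL = vector [vector [1, 1], vector [0, 1]]"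
definition matR :: "int^2^2" where "matR = vector [vector [1, 0], vector [1, 1]]"
definition matS :: "int^2^2" where "matS = vector [vector [0, -1], vector [1, 0]]"
definition matU :: "int^2^2" where "matU = vector [vector [0, -1], vector [1, -1]]"

definition abel :: "word \<Rightarrow> int^2" where
  "abel w = vector [int (count_list w La) - int (count_list w LA),
                    int (count_list w Lb) - int (count_list w LB)]"

text \<open>The columns are the abelianized images of the two generators.\<close>

definition abel_mat :: "(word \<Rightarrow> word) \<Rightarrow> int^2^2" where
  "abel_mat \<phi> = transpose (vector [abel (\<phi> [La]), abel (\<phi> [Lb])])"

text \<open>
  Mapping classes are identified with elements of \<open>SL2Z\<close>, i.e. with the outer automorphisms of
  \<open>F2\<close> of determinant 1.  A matrix acts on curves through any automorphism inducing it on the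
  abelianization; by Nielsen's theorem such an automorphism exists and is unique up to inner
  automorphisms, so the image curve does not depend on the choice.
\<close>

definition mod_act :: "int^2^2 \<Rightarrow> curve \<Rightarrow> curve" where
  "mod_act M \<gamma> = (THE \<delta>. \<exists>\<phi>\<in>iso F2 F2. abel_mat \<phi> = M \<and> \<delta> = \<phi> ` \<gamma>)"

definition mod_orbit :: "curve \<Rightarrow> curve set" where
  "mod_orbit \<gamma> = (\<lambda>M. mod_act M \<gamma>) ` carrier SL2Z"

definition mod_stab :: "curve \<Rightarrow> (int^2^2) set" where
  "mod_stab \<gamma> = {M \<in> carrier SL2Z. mod_act M \<gamma> = \<gamma>}"

definition standard_position :: "curve \<Rightarrow> bool" where
  "standard_position \<gamma> \<longleftrightarrow> mod_stab \<gamma> \<in>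
     {{matI}, generate SL2Z {- matI}, generate SL2Z {matU}, generate SL2Z {matS},
      generate SL2Z {- matU}, generate SL2Z {matL}, generate SL2Z {- matL},
      generate SL2Z {- matI, matL}}"

definition has_nontrivial_torsion :: "(int^2^2) set \<Rightarrow> bool" where
  "has_nontrivial_torsion H \<longleftrightarrow>
     (\<exists>M\<in>H. M \<noteq> \<one>\<^bsub>SL2Z\<^esub> \<and> (\<exists>k::nat. k > 0 \<and> M [^]\<^bsub>SL2Z\<^esub> k = \<one>\<^bsub>SL2Z\<^esub>))"

inductive_set LR_monoid :: "(int^2^2) set" where
  one: "matI \<in> LR_monoid"
| L: "M \<in> LR_monoid \<Longrightarrow> matL ** M \<in> LR_monoid"
| R: "M \<in> LR_monoid \<Longrightarrow> matR ** M \<in> LR_monoid"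

definition tree :: "curve \<Rightarrow> curve set" where
  "tree \<gamma> = (\<lambda>M. mod_act M \<gamma>) ` LR_monoid"

end

theory Submission
  imports Defs
begin

text \<open>
  Every matrix of determinant 1 becomes, after some quarter turns, a member of the positive monoid
  or such a member times \<open>matS\<close>; this is decided by the quadrants of its columns. Since mapping
  classes act on curves through matrices (Nielsen: an automorphism of \<open>F2\<close> that is trivial on the
  abelianization is inner), this gives the first part.

  For the second part, the rotations \<open>matS\<close> act on the curves of length \<open>n\<close> in the orbit. An equality
  \<open>S\<^sup>k M \<gamma> = M' \<gamma>\<close> between tree members means \<open>S\<^sup>k M h = M'\<close> for some \<open>h\<close> in the stabilizer, and inspecting
  quadrants for the possible stabilizers shows that \<open>k\<close> is even unless the curve is as short as \<open>\<gamma>\<close>. A half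
  turn preserves the trees if \<open>-I\<close> or \<open>U\<close> is in the stabilizer, and it moves them off themselves if the
  stabilizer is contained in that generated by \<open>L\<close>. The remaining group generated by \<open>-L\<close> does not occur as a stabilizer:
  the curves fixed by \<open>L\<^sup>2\<close> are already fixed by \<open>L\<close>.
\<close>

section \<open>Calculus in the free group\<close>

text \<open>Curves are counted, not matrices: \<open>M\<close> \<mapsto>
  \<open>mod_act M \<gamma>\<close> need not be injective on the matrices that describe the trees,
  and the two trees may overlap. Hence every coincidence of curves is traded for a matrix equation
  with an unknown stabilizer element \<open>h\<close>. Standard position bounds \<open>h\<close>:
  each listed group lies in the centralizer of \<open>matS\<close>, \<open>matU\<close> or
  \<open>matL\<close>. In the first two cases determinant 1 leaves four or six matrices, the units
  of a binary norm form; in the third, \<open>h\<close> is up to sign a power of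
  \<open>matL\<close>.

  The bound n > \<ell>(\<gamma>) cannot simply be dropped from the argument: \<gamma> and
  S(\<gamma>) both lie in the union of the trees and differ by a quarter turn. The length function
  itself enters only through its invariance under \<open>matS\<close>, which merely renames letters.

  Most of the work lies below this. \<open>mod_act\<close> is a definite description over
  automorphisms, so it says nothing until Nielsen's theorem is available. That theorem is obtained
  from a normal form of bases whose abelianization never cancels, together with length reduction of
  generating pairs.\<close>

abbreviation mul :: "word \<Rightarrow> word \<Rightarrow> word" (infixr "\<cdot>" 70) where
  "u \<cdot> v \<equiv> foldr lcons u v"

definition winv :: "word \<Rightarrow> word" where
  "winv w = rev (map linv w)"

lemma winv_simps [simp]:
  "winv [] = []" "winv (x # w) = winv w @ [linv x]" "winv (u @ v) = winv v @ winv u"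
  "winv (winv w) = w" "length (winv w) = length w" "winv w = [] \<longleftrightarrow> w = []"
  by (auto simp: winv_def rev_map o_def)

lemma linv_eq_iff [simp]: "linv x = linv y \<longleftrightarrow> x = y"
  by (metis linv_linv)

lemma linv_neq [simp]: "linv x \<noteq> x" "x \<noteq> linv x"
  by (cases x; simp)+

lemma reduced_append:
  "reduced (u @ v) \<longleftrightarrow> reduced u \<and> reduced v \<and> (u \<noteq> [] \<and> v \<noteq> [] \<longrightarrow> hd v \<noteq> linv (last u))"
  by (auto simp: reduced_def successively_append_iff)

lemma reduced_single [simp]: "reduced [x]"
  by (simp add: reduced_Cons)

lemma reduced_winv [simp]: "reduced (winv w) \<longleftrightarrow> reduced w"
proof -
  have "reduced (winv w)" if "reduced w" for w
    using that
  proof (induction w)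
    case (Cons x w)
    then show ?case
      by (cases w) (auto simp: reduced_append reduced_Cons winv_def last_rev last_map hd_map)
  qed simp
  from this[of w] this[of "winv w"] show ?thesis by auto
qed

lemma mul_eq_append: "reduced (u @ v) \<Longrightarrow> u \<cdot> v = u @ v"
  by (induction u) (auto simp: lcons_reduced reduced_Cons)

lemma reduced_mul [simp]: "reduced v \<Longrightarrow> reduced (u \<cdot> v)"
  by (rule reduced_foldr_lcons)

lemma mul_Nil [simp]: "reduced u \<Longrightarrow> u \<cdot> [] = u"
  by (rule foldr_lcons_Nil)

lemma mul_assoc [simp]: "reduced v \<Longrightarrow> reduced w \<Longrightarrow> (u \<cdot> v) \<cdot> w = u \<cdot> v \<cdot> w"
  by (rule foldr_lcons_assoc)

lemma mul_winv_cancel [simp]: "reduced v \<Longrightarrow> u \<cdot> winv u \<cdot> v = v"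
  by (induction u arbitrary: v) (auto simp: reduced_lcons lcons_cancel)

lemma winv_mul_cancel [simp]: "reduced v \<Longrightarrow> winv u \<cdot> u \<cdot> v = v"
  using mul_winv_cancel[of v "winv u"] by simp

lemma mul_winv [simp]: "reduced u \<Longrightarrow> u \<cdot> winv u = []"
  using mul_winv_cancel[of "[]" u] by simp

lemma winv_mul [simp]: "reduced u \<Longrightarrow> winv u \<cdot> u = []"
  using mul_winv[of "winv u"] by simp

interpretation F2: group F2
  by (rule group_F2)

lemma inv_F2 [simp]: "reduced w \<Longrightarrow> inv\<^bsub>F2\<^esub> w = winv w"
  by (rule F2.inv_equality) auto

lemma winv_mul_distrib [simp]:
  assumes "reduced u" "reduced v"
  shows "winv (u \<cdot> v) = winv v \<cdot> winv u"
  using F2.inv_mult_group[of u v] assms by simp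

lemma mul_left_cancel: "reduced v \<Longrightarrow> reduced w \<Longrightarrow> u \<cdot> v = u \<cdot> w \<longleftrightarrow> v = w"
  by (metis winv_mul_cancel)

lemma length_lcons: "length (lcons x w) \<le> Suc (length w)"
  by (cases w) auto

lemma length_mul: "length (u \<cdot> v) \<le> length u + length v"
proof (induction u)
  case (Cons x u)
  then show ?case using length_lcons[of x "u \<cdot> v"] by simp
qed simp

section \<open>Endomorphisms of the free group as substitutions\<close>

fun img :: "word \<Rightarrow> word \<Rightarrow> letter \<Rightarrow> word" where
  "img x y La = x"
| "img x y Lb = y"
| "img x y LA = winv x"
| "img x y LB = winv y"

definition sub :: "word \<Rightarrow> word \<Rightarrow> word \<Rightarrow> word" where
  "sub x y w = foldr (\<lambda>l z. img x y l \<cdot> z) w []"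

lemma sub_simps [simp]:
  "sub x y [] = []" "sub x y (l # w) = img x y l \<cdot> sub x y w"
  by (simp_all add: sub_def)

lemma img_linv [simp]: "img x y (linv l) = winv (img x y l)"
  by (cases l) auto

lemma reduced_img [simp]: "reduced x \<Longrightarrow> reduced y \<Longrightarrow> reduced (img x y l)"
  by (cases l) auto

lemma reduced_sub [simp]: "reduced (sub x y w)"
  by (induction w) auto

lemma sub_append [simp]: "sub x y (u @ v) = sub x y u \<cdot> sub x y v"
  by (induction u) auto

lemma sub_lcons [simp]: "sub x y (lcons l w) = img x y l \<cdot> sub x y w"
  by (cases w) auto

lemma sub_mul [simp]: "sub x y (u \<cdot> v) = sub x y u \<cdot> sub x y v"
  by (induction u) auto

lemma sub_winv [simp]: "reduced x \<Longrightarrow> reduced y \<Longrightarrow> sub x y (winv w) = winv (sub x y w)"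
  by (induction w) auto

lemma sub_sub:
  assumes "reduced x" "reduced y"
  shows "sub x y (sub p q w) = sub (sub x y p) (sub x y q) w"
proof (induction w)
  case (Cons l w)
  have "sub x y (img p q l) = img (sub x y p) (sub x y q) l"
    using assms by (cases l) auto
  with Cons show ?case by simp
qed simp

lemma sub_letters [simp]: "reduced w \<Longrightarrow> sub [La] [Lb] w = w"
proof (induction w)
  case (Cons l w)
  have "img [La] [Lb] l = [l]" by (cases l) auto
  with Cons show ?case by (simp add: reduced_Cons lcons_reduced)
qed simp

lemma sub_conj:
  assumes "reduced x" "reduced y" "reduced g"
  shows "sub (g \<cdot> x \<cdot> winv g) (g \<cdot> y \<cdot> winv g) w = g \<cdot> sub x y w \<cdot> winv g"
proof (induction w)
  case (Cons l w)
  have "img (g \<cdot> x \<cdot> winv g) (g \<cdot> y \<cdot> winv g) l = g \<cdot> img x y l \<cdot> winv g"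
    using assms by (cases l) auto
  with Cons show ?case using assms by simp
qed (use assms in simp)

lemma hom_eq_sub:
  assumes "\<phi> \<in> hom F2 F2" "reduced w"
  shows "\<phi> w = sub (\<phi> [La]) (\<phi> [Lb]) w"
proof -
  have mult: "\<phi> (u \<cdot> v) = \<phi> u \<cdot> \<phi> v" if "reduced u" "reduced v" for u v
    using assms(1) that by (auto simp: hom_def)
  have red: "reduced (\<phi> u)" if "reduced u" for u
    using assms(1) that by (auto simp: hom_def)
  have one: "\<phi> [] = []"
    using mult[of "[]" "[]"] red[of "[]"] mul_left_cancel[of "\<phi> []" "[]" "\<phi> []"] by auto
  have inv: "\<phi> (winv u) = winv (\<phi> u)" if "reduced u" for u
    using mult[of u "winv u"] red[of u] red[of "winv u"] one that
      winv_mul_cancel[of "\<phi> (winv u)" "\<phi> u"] by auto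
  have letter: "\<phi> [l] = img (\<phi> [La]) (\<phi> [Lb]) l" for l
    using inv[of "[La]"] inv[of "[Lb]"] by (cases l) auto
  show ?thesis
    using assms(2)
  proof (induction w)
    case (Cons l w)
    then have "\<phi> (l # w) = \<phi> [l] \<cdot> \<phi> w"
      using mult[of "[l]" w] by (auto simp: reduced_Cons lcons_reduced)
    with Cons letter[of l] show ?case by (simp add: reduced_Cons)
  qed (simp add: one)
qed

lemma sub_hom: "sub x y \<in> hom F2 F2"
  by (auto simp: hom_def)

text \<open>\<open>sub p q\<close> is the inverse map: both composites fix the two letters, hence
  every reduced word.\<close>

lemma sub_iso:
  assumes "reduced x" "reduced y" "reduced p" "reduced q"
    and "sub x y p = [La]" "sub x y q = [Lb]" "sub p q x = [La]" "sub p q y = [Lb]"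
  shows "sub x y \<in> iso F2 F2"
proof (rule isoI[OF sub_hom])
  show "bij_betw (sub x y) (carrier F2) (carrier F2)"
    by (rule bij_betw_byWitness[where f' = "sub p q"]) (use assms in \<open>auto simp: sub_sub\<close>)
qed

section \<open>Abelianization and matrices\<close>

definition ca :: "word \<Rightarrow> int" where
  "ca w = int (count_list w La) - int (count_list w LA)"

definition cb :: "word \<Rightarrow> int" where
  "cb w = int (count_list w Lb) - int (count_list w LB)"

lemma c_simps [simp]:
  "ca [] = 0" "cb [] = 0"
  "ca (La # w) = ca w + 1" "ca (LA # w) = ca w - 1" "ca (Lb # w) = ca w" "ca (LB # w) = ca w"
  "cb (Lb # w) = cb w + 1" "cb (LB # w) = cb w - 1" "cb (La # w) = cb w" "cb (LA # w) = cb w"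
  by (auto simp: ca_def cb_def)

lemma c_lcons [simp]: "ca (lcons l w) = ca [l] + ca w" "cb (lcons l w) = cb [l] + cb w"
  by (cases w; cases l; auto)+

lemma c_mul [simp]: "ca (u \<cdot> v) = ca u + ca v" "cb (u \<cdot> v) = cb u + cb v"
proof -
  have "ca (u \<cdot> v) = ca u + ca v \<and> cb (u \<cdot> v) = cb u + cb v"
  proof (induction u)
    case (Cons l u)
    then show ?case by (cases l) auto
  qed simp
  then show "ca (u \<cdot> v) = ca u + ca v" "cb (u \<cdot> v) = cb u + cb v" by auto
qed

lemma c_append [simp]: "ca (u @ v) = ca u + ca v" "cb (u @ v) = cb u + cb v"
  by (auto simp: ca_def cb_def)

lemma c_winv [simp]: "ca (winv w) = - ca w" "cb (winv w) = - cb w"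
proof -
  have "ca (winv w) = - ca w \<and> cb (winv w) = - cb w"
  proof (induction w)
    case (Cons l w)
    then show ?case by (cases l) auto
  qed simp
  then show "ca (winv w) = - ca w" "cb (winv w) = - cb w" by auto
qed

lemma c_sub [simp]:
  "ca (sub x y w) = ca x * ca w + ca y * cb w"
  "cb (sub x y w) = cb x * ca w + cb y * cb w"
proof -
  have "ca (sub x y w) = ca x * ca w + ca y * cb w \<and> cb (sub x y w) = cb x * ca w + cb y * cb w"
  proof (induction w)
    case (Cons l w)
    then show ?case by (cases l) (auto simp: algebra_simps)
  qed simp
  then show "ca (sub x y w) = ca x * ca w + ca y * cb w" "cb (sub x y w) = cb x * ca w + cb y * cb w"
    by auto
qed

definition mat2 :: "int \<Rightarrow> int \<Rightarrow> int \<Rightarrow> int \<Rightarrow> int^2^2" where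
  "mat2 p q r s = vector [vector [p, q], vector [r, s]]"

lemma mat2_nth [simp]:
  "mat2 p q r s $ 1 $ 1 = p" "mat2 p q r s $ 1 $ 2 = q"
  "mat2 p q r s $ 2 $ 1 = r" "mat2 p q r s $ 2 $ 2 = s"
  by (simp_all add: mat2_def)

lemma mat2_eqI: "M = mat2 (M$1$1) (M$1$2) (M$2$1) (M$2$2)"
  by (simp add: vec_eq_iff forall_2)

lemma mat2_cases: obtains p q r s where "M = mat2 p q r s"
  using mat2_eqI by blast

lemma mat2_eq_iff [simp]: "mat2 p q r s = mat2 p' q' r' s' \<longleftrightarrow> p = p' \<and> q = q' \<and> r = r' \<and> s = s'"
  by (metis mat2_nth)

lemma mat2_mult [simp]:
  "mat2 p q r s ** mat2 p' q' r' s' = mat2 (p * p' + q * r') (p * q' + q * s') (r * p' + s * r') (r * q' + s * s')"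
  by (simp add: vec_eq_iff forall_2 matrix_matrix_mult_def sum_2)

lemma mat2_uminus [simp]: "- mat2 p q r s = mat2 (-p) (-q) (-r) (-s)"
  by (simp add: vec_eq_iff forall_2)

lemma det_mat2 [simp]: "det (mat2 p q r s) = p * s - q * r"
  by (simp add: det_2)

lemma mats:
  "mat 1 = mat2 1 0 0 1" "matI = mat2 1 0 0 1" "matL = mat2 1 1 0 1" "matR = mat2 1 0 1 1"
  "matS = mat2 0 (-1) 1 0" "matU = mat2 0 (-1) 1 (-1)"
  by (simp_all add: matI_def matL_def matR_def matS_def matU_def mat2_def[symmetric]
      vec_eq_iff forall_2 mat_def)

lemma abel_mat: "abel_mat \<phi> = mat2 (ca (\<phi> [La])) (ca (\<phi> [Lb])) (cb (\<phi> [La])) (cb (\<phi> [Lb]))"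
  by (simp add: abel_mat_def abel_def ca_def cb_def vec_eq_iff forall_2 transpose_def)

lemma abel_mat_comp:
  assumes "\<phi> \<in> hom F2 F2" "\<psi> \<in> hom F2 F2"
  shows "abel_mat (\<phi> \<circ> \<psi>) = abel_mat \<phi> ** abel_mat \<psi>"
proof -
  have "reduced (\<psi> [l])" for l
    using assms(2) by (auto simp: hom_def)
  then show ?thesis
    by (simp add: abel_mat hom_eq_sub[OF assms(1), of "\<psi> _"])
qed

section \<open>Bases of the free group\<close>

text \<open>Starting from all four rotations of (a, b) keeps the two abelianized columns in a common
  closed quadrant, so the positive moves never cancel in the abelianization.\<close>

inductive_set LRbases :: "(word \<times> word) set" where
  base: "(x, y) \<in> {([La], [Lb]), ([Lb], [LA]), ([LA], [LB]), ([LB], [La])} \<Longrightarrow> (x, y) \<in> LRbases"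
| L: "(x, y) \<in> LRbases \<Longrightarrow> (x, x \<cdot> y) \<in> LRbases"
| R: "(x, y) \<in> LRbases \<Longrightarrow> (x \<cdot> y, y) \<in> LRbases"

text \<open>A normal form for bases of determinant 1: positive moves, then quarter turns and
  conjugations. General Nielsen moves are deliberately not constructors; closure under them is
  proved in \<open>nbases_moves\<close>, so that the abelian size can be controlled by rule
  induction in \<open>nbases_size\<close>.\<close>

inductive_set nbases :: "(word \<times> word) set" where
  LR: "(x, y) \<in> LRbases \<Longrightarrow> (x, y) \<in> nbases"
| rot: "(x, y) \<in> nbases \<Longrightarrow> (y, winv x) \<in> nbases"
| conj: "(x, y) \<in> nbases \<Longrightarrow> reduced g \<Longrightarrow> (g \<cdot> x \<cdot> winv g, g \<cdot> y \<cdot> winv g) \<in> nbases"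

lemma LRbases_reduced: "(x, y) \<in> LRbases \<Longrightarrow> reduced x \<and> reduced y"
  by (induction rule: LRbases.induct) auto

lemma nbases_reduced: "(x, y) \<in> nbases \<Longrightarrow> reduced x \<and> reduced y"
  by (induction rule: nbases.induct) (auto dest: LRbases_reduced)

lemma nbases_unrot:
  assumes "(y, winv x) \<in> nbases"
  shows "(x, y) \<in> nbases"
  using nbases.rot[OF nbases.rot[OF nbases.rot[OF assms]]] by simp

text \<open>For a letter basis, an inverse move is a positive move on a rotated letter basis. After
  a positive move, the inverse of the same kind goes back, and the inverse of the other kind is, up
  to a turn and a conjugation, the other positive move applied to the previous pair.\<close>

lemma LRbases_unmove:
  "(x, y) \<in> LRbases \<Longrightarrow> (x, winv x \<cdot> y) \<in> nbases \<and> (x \<cdot> winv y, y) \<in> nbases"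
proof (induction rule: LRbases.induct)
  case (base x y)
  have "(winv y, x) \<in> LRbases" "(y, winv x) \<in> LRbases"
    using base by (auto intro!: LRbases.base)
  from LRbases.R[OF this(1)] LRbases.L[OF this(2)]
  have "(winv y \<cdot> x, x) \<in> nbases" "(y, y \<cdot> winv x) \<in> nbases"
    by (auto intro: nbases.LR)
  from nbases.rot[OF this(1)] nbases_unrot[of y "x \<cdot> winv y"] this(2) base
  show ?case by auto
next
  case (L x y)
  have red: "reduced x" "reduced y" using LRbases_reduced L by auto
  have "(x \<cdot> y, winv (winv y)) \<in> nbases"
    using L by (auto intro: nbases.LR LRbases.R)
  from nbases.conj[OF nbases_unrot[OF this], of "x \<cdot> y"]
  have "(x \<cdot> winv (x \<cdot> y), x \<cdot> y) \<in> nbases"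
    using red by simp
  with L red show ?case by (auto intro: nbases.LR)
next
  case (R x y)
  have red: "reduced x" "reduced y" using LRbases_reduced R by auto
  have "(x \<cdot> y, winv x) \<in> nbases"
    using R by (auto intro: nbases.LR nbases.rot LRbases.L)
  from nbases.conj[OF this, of "winv (x \<cdot> y)"]
  have "(x \<cdot> y, winv (x \<cdot> y) \<cdot> y) \<in> nbases"
    using red by simp
  with R red show ?case by (auto intro: nbases.LR)
qed

text \<open>The four moves are treated jointly because a quarter turn permutes them, up to replacing
  left by right multiplication, which is a conjugation.\<close>

lemma nbases_moves_aux:
  "(x, y) \<in> nbases \<Longrightarrow>
    {(x, x \<cdot> y), (x, winv x \<cdot> y), (x \<cdot> y, y), (x \<cdot> winv y, y)} \<subseteq> nbases"
proof (induction rule: nbases.induct)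
  case (LR x y)
  then show ?case
    using LRbases_unmove[OF LR] nbases.LR[OF LRbases.L[OF LR]] nbases.LR[OF LRbases.R[OF LR]]
    by simp
next
  case (rot x y)
  have red: "reduced x" "reduced y" using nbases_reduced rot by auto
  have 1: "(y, y \<cdot> winv x) \<in> nbases" "(y, winv y \<cdot> winv x) \<in> nbases"
    using rot.IH nbases.rot[of "x \<cdot> winv y" y] nbases.rot[of "x \<cdot> y" y] red by simp_all
  have "(x, winv x \<cdot> y) \<in> nbases" "(x, x \<cdot> y) \<in> nbases"
    using rot.IH by simp_all
  from nbases.conj[OF this(1), of x] nbases.conj[OF this(2), of "winv x"]
  have "(x, y \<cdot> winv x) \<in> nbases" "(x, y \<cdot> x) \<in> nbases"
    using red by simp_all
  then have "(y \<cdot> winv x, winv x) \<in> nbases" "(y \<cdot> x, winv x) \<in> nbases"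
    by (simp_all add: nbases.rot)
  with 1 red show ?case by auto
next
  case (conj x y g)
  have red: "reduced x" "reduced y" using nbases_reduced conj by auto
  have "\<And>u v. (u, v) \<in> nbases \<Longrightarrow> (g \<cdot> u \<cdot> winv g, g \<cdot> v \<cdot> winv g) \<in> nbases"
    using conj nbases.conj by blast
  from this[of x "x \<cdot> y"] this[of x "winv x \<cdot> y"] this[of "x \<cdot> y" y] this[of "x \<cdot> winv y" y]
  show ?case using conj red by simp
qed

lemma nbases_moves:
  assumes "(x, y) \<in> nbases"
  shows "(x, x \<cdot> y) \<in> nbases" "(x, winv x \<cdot> y) \<in> nbases" "(x \<cdot> y, y) \<in> nbases"
    "(x \<cdot> winv y, y) \<in> nbases" "(x, y \<cdot> x) \<in> nbases" "(x, y \<cdot> winv x) \<in> nbases"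
    "(y \<cdot> x, y) \<in> nbases" "(winv y \<cdot> x, y) \<in> nbases"
proof -
  have red: "reduced x" "reduced y" using nbases_reduced assms by auto
  show *: "(x, x \<cdot> y) \<in> nbases" "(x, winv x \<cdot> y) \<in> nbases" "(x \<cdot> y, y) \<in> nbases"
    "(x \<cdot> winv y, y) \<in> nbases"
    using nbases_moves_aux[OF assms] by auto
  show "(x, y \<cdot> x) \<in> nbases" "(x, y \<cdot> winv x) \<in> nbases"
    "(y \<cdot> x, y) \<in> nbases" "(winv y \<cdot> x, y) \<in> nbases"
    using nbases.conj[OF *(1), of "winv x"] nbases.conj[OF *(2), of x]
      nbases.conj[OF *(3), of y] nbases.conj[OF *(4), of "winv y"] red by simp_all
qed

text \<open>Coordinates of equal sign make absolute values additive, so the signs persist under both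
  moves.\<close>

lemma LRbases_abel:
  "(x, y) \<in> LRbases \<Longrightarrow>
     ca x * ca y \<ge> 0 \<and> cb x * cb y \<ge> 0 \<and> \<bar>ca x\<bar> + \<bar>cb x\<bar> \<ge> 1 \<and> \<bar>ca y\<bar> + \<bar>cb y\<bar> \<ge> 1"
proof (induction rule: LRbases.induct)
  case (L x y)
  have "\<bar>ca x + ca y\<bar> = \<bar>ca x\<bar> + \<bar>ca y\<bar>" "\<bar>cb x + cb y\<bar> = \<bar>cb x\<bar> + \<bar>cb y\<bar>"
    using L.IH by (auto simp: zero_le_mult_iff)
  with L.IH show ?case by (auto simp: algebra_simps)
next
  case (R x y)
  have "\<bar>ca x + ca y\<bar> = \<bar>ca x\<bar> + \<bar>ca y\<bar>" "\<bar>cb x + cb y\<bar> = \<bar>cb x\<bar> + \<bar>cb y\<bar>"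
    using R.IH by (auto simp: zero_le_mult_iff)
  with R.IH show ?case by (auto simp: algebra_simps)
qed auto

definition letter_bases :: "(word \<times> word) set" where
  "letter_bases = {([La], [Lb]), ([Lb], [LA]), ([LA], [LB]), ([LB], [La])}"

lemma LRbases_size:
  "(x, y) \<in> LRbases \<Longrightarrow>
     (x, y) \<in> letter_bases \<or> \<bar>ca x\<bar> + \<bar>cb x\<bar> + \<bar>ca y\<bar> + \<bar>cb y\<bar> \<ge> 3"
proof (induction rule: LRbases.induct)
  case (L x y)
  have "\<bar>ca x + ca y\<bar> = \<bar>ca x\<bar> + \<bar>ca y\<bar>" "\<bar>cb x + cb y\<bar> = \<bar>cb x\<bar> + \<bar>cb y\<bar>"
    using LRbases_abel[OF L.hyps] by (auto simp: zero_le_mult_iff)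
  with LRbases_abel[OF L.hyps] show ?case by auto
next
  case (R x y)
  have "\<bar>ca x + ca y\<bar> = \<bar>ca x\<bar> + \<bar>ca y\<bar>" "\<bar>cb x + cb y\<bar> = \<bar>cb x\<bar> + \<bar>cb y\<bar>"
    using LRbases_abel[OF R.hyps] by (auto simp: zero_le_mult_iff)
  with LRbases_abel[OF R.hyps] show ?case by auto
qed (auto simp: letter_bases_def)

text \<open>Turns and conjugations preserve the sum of the absolute values, whereas a single
  positive move already raises it above 2, its value on letter bases.\<close>

lemma nbases_size:
  "(x, y) \<in> nbases \<Longrightarrow>
     (\<exists>g p q. reduced g \<and> (p, q) \<in> letter_bases \<and> x = g \<cdot> p \<cdot> winv g \<and> y = g \<cdot> q \<cdot> winv g) \<or>
     \<bar>ca x\<bar> + \<bar>cb x\<bar> + \<bar>ca y\<bar> + \<bar>cb y\<bar> \<ge> 3"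
proof (induction rule: nbases.induct)
  case (LR x y)
  then show ?case
    using LRbases_size[OF LR] LRbases_reduced[OF LR] mul_Nil reduced_Nil
    by (metis foldr_Nil id_apply winv_simps(1))
next
  case (rot x y)
  from rot.IH show ?case
  proof
    assume "\<exists>g p q. reduced g \<and> (p, q) \<in> letter_bases \<and> x = g \<cdot> p \<cdot> winv g \<and> y = g \<cdot> q \<cdot> winv g"
    then obtain g p q where g: "reduced g" "(p, q) \<in> letter_bases"
      "x = g \<cdot> p \<cdot> winv g" "y = g \<cdot> q \<cdot> winv g" by blast
    have "reduced p" using g(2) by (auto simp: letter_bases_def)
    then have "winv x = g \<cdot> winv p \<cdot> winv g"
      using g(1,3) by simp
    moreover have "(q, winv p) \<in> letter_bases"
      using g(2) by (auto simp: letter_bases_def)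
    ultimately have "winv x = g \<cdot> winv p \<cdot> winv g" "(q, winv p) \<in> letter_bases" by auto
    with g show ?thesis by blast
  qed auto
next
  case (conj x y g)
  from conj.IH show ?case
  proof
    assume "\<exists>h p q. reduced h \<and> (p, q) \<in> letter_bases \<and> x = h \<cdot> p \<cdot> winv h \<and> y = h \<cdot> q \<cdot> winv h"
    then obtain h p q where h: "reduced h" "(p, q) \<in> letter_bases"
      "x = h \<cdot> p \<cdot> winv h" "y = h \<cdot> q \<cdot> winv h" by blast
    have "reduced p" "reduced q" using h(2) by (auto simp: letter_bases_def)
    then have "g \<cdot> x \<cdot> winv g = (g \<cdot> h) \<cdot> p \<cdot> winv (g \<cdot> h)"
      "g \<cdot> y \<cdot> winv g = (g \<cdot> h) \<cdot> q \<cdot> winv (g \<cdot> h)"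
      using h conj.hyps by simp_all
    with h conj.hyps show ?thesis by (metis reduced_mul)
  qed auto
qed

lemma nbases_inner:
  assumes "(x, y) \<in> nbases" "ca x = 1" "cb x = 0" "ca y = 0" "cb y = 1"
  shows "\<exists>g. reduced g \<and> x = g \<cdot> [La] \<cdot> winv g \<and> y = g \<cdot> [Lb] \<cdot> winv g"
  using nbases_size[OF assms(1)] assms(2-) by (auto simp: letter_bases_def)

section \<open>Nielsen reduction\<close>

lemma mul_decomp:
  assumes "reduced u" "reduced v"
  obtains u' p v' where "u = u' @ p" "v = winv p @ v'" "u \<cdot> v = u' @ v'" "reduced (u' @ v')"
proof -
  have "\<exists>u' p v'. u = u' @ p \<and> v = winv p @ v' \<and> reduced (u' @ v')"
    using assms(1)
  proof (induction u)
    case (Cons x u)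
    then obtain u' p v' where *: "u = u' @ p" "v = winv p @ v'" "reduced (u' @ v')"
      by (auto simp: reduced_Cons)
    show ?case
    proof (cases "u' = [] \<and> v' \<noteq> [] \<and> hd v' = linv x")
      case True
      then show ?thesis using * Cons.prems
        by (intro exI[of _ "[]"] exI[of _ "x # p"] exI[of _ "tl v'"])
           (cases v'; auto simp: reduced_Cons)
    next
      case False
      then have "reduced ((x # u') @ v')"
        using * Cons.prems by (cases u') (auto simp: reduced_Cons)
      then show ?thesis using *
        by (intro exI[of _ "x # u'"] exI[of _ p] exI[of _ v']) auto
    qed
  qed (use assms in auto)
  then obtain u' p v' where *: "u = u' @ p" "v = winv p @ v'" "reduced (u' @ v')" by blast
  have red: "reduced u'" "reduced p" "reduced v'"
    using * assms by (auto simp: reduced_append)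
  have "u = u' \<cdot> p" "v = winv p \<cdot> v'" "u' @ v' = u' \<cdot> v'"
    using * assms by (auto simp: mul_eq_append)
  then have "u \<cdot> v = u' @ v'" using red by simp
  with * that show ?thesis by blast
qed

text \<open>For reduced words this is the number of letters lost at the end of \<open>u\<close>,
  equally at the start of \<open>v\<close>; the division by 2 is then exact.\<close>

definition cancel :: "word \<Rightarrow> word \<Rightarrow> nat" where
  "cancel u v = (length u + length v - length (u \<cdot> v)) div 2"

lemma cancel_decomp:
  assumes "reduced u" "reduced v"
  obtains u' p v' where "u = u' @ p" "v = winv p @ v'" "u \<cdot> v = u' @ v'" "reduced (u' @ v')"
    "length p = cancel u v"
proof -
  obtain u' p v' where *: "u = u' @ p" "v = winv p @ v'" "u \<cdot> v = u' @ v'" "reduced (u' @ v')"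
    using mul_decomp[OF assms] by blast
  then have "length u + length v - length (u \<cdot> v) = 2 * length p" by simp
  with * that show ?thesis by (simp add: cancel_def)
qed


lemma length_mul_cancel:
  assumes "reduced u" "reduced v"
  shows "length (u \<cdot> v) + 2 * cancel u v = length u + length v"
proof -
  obtain u' p v' where "u = u' @ p" "v = winv p @ v'" "u \<cdot> v = u' @ v'" "length p = cancel u v"
    using cancel_decomp[OF assms] by metis
  then show ?thesis by simp
qed

text \<open>There is no element of order two: stripping the outer letters would end at a letter
  equal to its own inverse.\<close>

lemma winv_eq_self: "reduced t \<Longrightarrow> winv t = t \<Longrightarrow> t = []"
proof (induction "length t" arbitrary: t rule: less_induct)
  case less
  show ?case
  proof (cases t)
    case (Cons x s)
    show ?thesis
    proof (cases s rule: rev_cases)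
      case Nil
      with Cons less.prems show ?thesis by simp
    next
      case (snoc r z)
      with Cons less.prems have "z = linv x" "winv r = r" "reduced r"
        by (auto simp: reduced_append reduced_Cons)
      with less.hyps[of r] Cons snoc less.prems show ?thesis
        by (auto simp: reduced_append reduced_Cons)
    qed
  qed simp
qed

lemma not_reduced_append_winv: "reduced (u @ winv u) \<Longrightarrow> u = []"
  by (cases u rule: rev_cases) (auto simp: reduced_append reduced_Cons)

text \<open>If at least half of \<open>u\<close> cancelled in the square, the overlap
  \<open>t\<close> of the two cancelled parts would be its own inverse, hence empty, and
  \<open>u\<close> would be a word followed by its inverse.\<close>

lemma cancel_self:
  assumes "reduced u" "u \<noteq> []"
  shows "2 * cancel u u < length u"
proof (rule ccontr)
  assume *: "\<not> ?thesis"
  obtain u' p v' where d: "u = u' @ p" "u = winv p @ v'" "length p = cancel u u"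
    using cancel_decomp[OF assms(1,1)] by metis
  then have "length u' \<le> length (winv p)" using * by (metis length_append winv_simps(5) mult_2 add_le_cancel_right not_less)
  then obtain t where t: "winv p = u' @ t"
    using d(1,2) by (metis append_eq_append_conv_if append_take_drop_id append_eq_conv_conj)
  then have p: "p = winv t @ winv u'" by (metis winv_simps(3,4))
  then have "u' @ winv t @ winv u' = u' @ t @ v'" using d(1,2) t by (metis append.assoc)
  then have "winv t = t" by simp
  moreover have "reduced t" using assms(1) d p by (auto simp: reduced_append)
  ultimately have "t = []" using winv_eq_self by blast
  then show False using not_reduced_append_winv[of u'] assms d(1) p by auto
qed

text \<open>\<open>C1\<close> and \<open>C2\<close> leave a nonempty piece of every factor, so the
  image of a reduced word has at least as many letters as the word. The exact initial part is
  recorded because a letter prepended later cancels into it.\<close>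

lemma sub_long:
  assumes red: "reduced x" "reduced y"
    and C1: "\<And>l m. m \<noteq> linv l \<Longrightarrow> cancel (img x y l) (img x y m) < length (img x y m)"
    and C2: "\<And>l m n. m \<noteq> linv l \<Longrightarrow> n \<noteq> linv m \<Longrightarrow>
      cancel (img x y l) (img x y m) + cancel (img x y m) (img x y n) < length (img x y m)"
  shows "reduced (l # w) \<Longrightarrow> \<exists>r. sub x y (l # w) =
    take (length (img x y l) - (if w = [] then 0 else cancel (img x y l) (img x y (hd w)))) (img x y l) @ r
    \<and> length w \<le> length r"
proof (induction w arbitrary: l)
  case (Cons m w)
  let ?I = "img x y"
  let ?k = "if w = [] then 0 else cancel (?I m) (?I (hd w))"
  have r: "reduced (m # w)" "m \<noteq> linv l" "w \<noteq> [] \<Longrightarrow> hd w \<noteq> linv m"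
    using Cons.prems by (auto simp: reduced_Cons)
  obtain r' where r': "sub x y (m # w) = take (length (?I m) - ?k) (?I m) @ r'" "length w \<le> length r'"
    using Cons.IH[OF r(1)] by blast
  obtain u' p v' where d: "?I l = u' @ p" "?I m = winv p @ v'" "reduced (u' @ v')"
    "length p = cancel (?I l) (?I m)"
    using cancel_decomp[of "?I l" "?I m"] red by (metis reduced_img)
  \<comment> \<open>The number of letters of \<open>?I m\<close> that survive on both sides;
    positivity keeps the left and right cancellations apart.\<close>
  define j where "j = length (?I m) - ?k - length p"
  have j: "0 < j" "j \<le> length v'"
    using C1[OF r(2)] C2[OF r(2), of "hd w"] r(3) d(2,4) by (auto simp: j_def)
  have "take (length (?I m) - ?k) (?I m) = winv p @ take j v'"
    using j by (auto simp: d(2) j_def)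
  with r' have s: "sub x y (m # w) = winv p @ take j v' @ r'" by simp
  have ne: "take j v' \<noteq> []" using j by auto
  have "reduced (winv p @ take j v' @ r')" using s reduced_sub by metis
  then have redt: "reduced (take j v' @ r')" "winv p @ take j v' @ r' = winv p \<cdot> (take j v' @ r')"
    by (auto simp: reduced_append mul_eq_append)
  have "reduced (u' @ take j v' @ drop j v')" using d(3) by simp
  then have redu: "reduced (u' @ take j v' @ r')"
    using redt(1) ne unfolding reduced_append by auto
  have "?I l = u' \<cdot> p" "reduced p"
    using d(1) red reduced_img[of x y l] by (auto simp: mul_eq_append reduced_append)
  then have "?I l \<cdot> sub x y (m # w) = (u' \<cdot> p) \<cdot> winv p \<cdot> (take j v' @ r')"
    using s redt(2) by metis
  also have "\<dots> = u' @ take j v' @ r'"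
    using \<open>reduced p\<close> redt(1) mul_eq_append[OF redu] by simp
  finally have "?I l \<cdot> sub x y (m # w) = u' @ take j v' @ r'" .
  moreover have "take (length (?I l) - (if m # w = [] then 0 else cancel (?I l) (?I (hd (m # w))))) (?I l) = u'"
    using d(1,4) by simp
  moreover have "length (m # w) \<le> length (take j v' @ r')"
    using r'(2) j by auto
  ultimately show ?case by (metis sub_simps(2))
qed (use red in simp)

text \<open>Generation is tested with an arbitrary, possibly unreduced word \<open>u\<close>; it
  passes to another pair as soon as \<open>x\<close> and \<open>y\<close> are words in that
  pair.\<close>

definition gen_pair :: "word \<Rightarrow> word \<Rightarrow> bool" where
  "gen_pair x y \<longleftrightarrow> reduced x \<and> reduced y \<and> ca x * cb y - ca y * cb x = 1 \<and>
     (\<forall>w. reduced w \<longrightarrow> (\<exists>u. sub x y u = w))"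

lemma gen_pair_change:
  assumes "gen_pair x y" "reduced p" "reduced q" "ca p * cb q - ca q * cb p = 1"
    "sub p q u = x" "sub p q v = y"
  shows "gen_pair p q"
  using assms sub_sub[OF assms(2,3)] unfolding gen_pair_def by metis

lemma gen_pair_conj:
  assumes "gen_pair x y" "reduced g"
  shows "gen_pair (g \<cdot> x \<cdot> winv g) (g \<cdot> y \<cdot> winv g)"
  unfolding gen_pair_def
proof (intro conjI allI impI)
  have red: "reduced x" "reduced y" using assms by (auto simp: gen_pair_def)
  fix w assume "reduced w"
  then obtain u where "sub x y u = winv g \<cdot> w \<cdot> g"
    using assms by (meson gen_pair_def reduced_mul)
  then have "sub (g \<cdot> x \<cdot> winv g) (g \<cdot> y \<cdot> winv g) u = w"
    using red assms(2) \<open>reduced w\<close> by (simp add: sub_conj)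
  then show "\<exists>u. sub (g \<cdot> x \<cdot> winv g) (g \<cdot> y \<cdot> winv g) u = w" by blast
qed (use assms in \<open>auto simp: gen_pair_def algebra_simps\<close>)

lemma gen_pair_moves:
  assumes "gen_pair x y"
  shows "gen_pair x (x \<cdot> y)" "gen_pair x (winv x \<cdot> y)" "gen_pair (x \<cdot> y) y"
    "gen_pair (x \<cdot> winv y) y" "gen_pair x (y \<cdot> x)" "gen_pair x (y \<cdot> winv x)"
    "gen_pair (y \<cdot> x) y" "gen_pair (winv y \<cdot> x) y" "gen_pair y (winv x)"
proof -
  have red: "reduced x" "reduced y" and det: "ca x * cb y - ca y * cb x = 1"
    using assms by (auto simp: gen_pair_def)
  note change = gen_pair_change[OF assms]
  show "gen_pair x (x \<cdot> y)" by (rule change[of _ _ "[La]" "[LA, Lb]"]) (use red det in \<open>auto simp: algebra_simps\<close>)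
  show "gen_pair x (winv x \<cdot> y)" by (rule change[of _ _ "[La]" "[La, Lb]"]) (use red det in \<open>auto simp: algebra_simps\<close>)
  show "gen_pair (x \<cdot> y) y" by (rule change[of _ _ "[La, LB]" "[Lb]"]) (use red det in \<open>auto simp: algebra_simps\<close>)
  show "gen_pair (x \<cdot> winv y) y" by (rule change[of _ _ "[La, Lb]" "[Lb]"]) (use red det in \<open>auto simp: algebra_simps\<close>)
  show "gen_pair x (y \<cdot> x)" by (rule change[of _ _ "[La]" "[Lb, LA]"]) (use red det in \<open>auto simp: algebra_simps\<close>)
  show "gen_pair x (y \<cdot> winv x)" by (rule change[of _ _ "[La]" "[Lb, La]"]) (use red det in \<open>auto simp: algebra_simps\<close>)
  show "gen_pair (y \<cdot> x) y" by (rule change[of _ _ "[LB, La]" "[Lb]"]) (use red det in \<open>auto simp: algebra_simps\<close>)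
  show "gen_pair (winv y \<cdot> x) y" by (rule change[of _ _ "[Lb, La]" "[Lb]"]) (use red det in \<open>auto simp: algebra_simps\<close>)
  show "gen_pair y (winv x)" by (rule change[of _ _ "[LB]" "[La]"]) (use red det in \<open>auto simp: algebra_simps\<close>)
qed


text \<open>Conjugation by the inverse of \<open>P\<close> produces the shorter pair
  \<open>(z, w)\<close>; the induction hypothesis applies to it, and \<open>nbases\<close> is closed
  under conjugating back.\<close>

lemma half_cancel_step:
  assumes IH: "\<And>p q. gen_pair p q \<Longrightarrow> length p + length q < length x + length y \<Longrightarrow> (p, q) \<in> nbases"
    and gen: "gen_pair x' y" and red: "reduced P" "reduced z" "reduced w"
    and eqs: "P \<cdot> z \<cdot> winv P = x'" "P \<cdot> w \<cdot> winv P = y"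
    and len: "length z + length w < length x + length y"
  shows "(x', y) \<in> nbases"
proof -
  have "gen_pair z w"
    using gen_pair_conj[OF gen, of "winv P"] red unfolding eqs[symmetric] by simp
  from nbases.conj[OF IH[OF this len] red(1)] show ?thesis
    using eqs by simp
qed

text \<open>If \<open>v = P Q\<^sup>-\<^sup>1\<close> is cancelled completely in \<open>u v u\<close>, where \<open>u = Q z P\<^sup>-\<^sup>1\<close>, then conjugating
  \<open>(v u, v)\<close> by \<open>P\<^sup>-\<^sup>1\<close> gives the shorter pair \<open>(z, Q\<^sup>-\<^sup>1 P)\<close>.\<close>

lemma half_cancel:
  assumes gen: "gen_pair x y"
    and IH: "\<And>p q. gen_pair p q \<Longrightarrow> length p + length q < length x + length y \<Longrightarrow> (p, q) \<in> nbases"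
    and u: "u \<in> {x, winv x}" and v: "v \<in> {y, winv y}"
    and eqs: "u = Q @ z @ winv P" "v = P @ winv Q" "length P = length Q" "P \<noteq> []"
  shows "(x, y) \<in> nbases"
proof -
  have red: "reduced x" "reduced y" using gen by (auto simp: gen_pair_def)
  then have "reduced u" "reduced v" using u v by auto
  then have redp: "reduced P" "reduced Q" "reduced z" "u = Q \<cdot> z \<cdot> winv P" "v = P \<cdot> winv Q"
    using mul_eq_append[of Q "z @ winv P"] mul_eq_append[of z "winv P"] mul_eq_append[of P "winv Q"]
    unfolding eqs(1,2) reduced_append reduced_winv by auto
  define w where "w = winv Q \<cdot> P"
  have w: "reduced w" "P \<cdot> w \<cdot> winv P = v" "P \<cdot> winv w \<cdot> winv P = winv v"
    using redp by (simp_all add: w_def)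
  have z: "P \<cdot> z \<cdot> winv P = v \<cdot> u" "P \<cdot> winv z \<cdot> winv P = winv (v \<cdot> u)"
    using redp by simp_all
  have "length w \<le> length P + length Q"
    using length_mul[of "winv Q" P] by (simp add: w_def)
  moreover have "length x = length u" "length y = length v" using u v by auto
  moreover have "0 < length P" using eqs(4) by simp
  ultimately have len: "length z + length w < length x + length y"
    unfolding \<open>length x = length u\<close> \<open>length y = length v\<close> using eqs(1-3)
    by (simp del: length_greater_0_conv)
  note step = half_cancel_step[where x = x and y = y, OF IH]
  note gens = gen_pair_moves[OF gen]
  \<comment> \<open>The signs decide which Nielsen move pairs \<open>v \<cdot> u\<close> or its
    inverse with \<open>y\<close>; the opposite move then returns to \<open>(x, y)\<close>.\<close>
  from u v consider "u = x" "v = y" | "u = x" "v = winv y" | "u = winv x" "v = y" | "u = winv x" "v = winv y"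
    by blast
  then show ?thesis
  proof cases
    case 1
    have "(y \<cdot> x, y) \<in> nbases"
      by (rule step[OF _ _ gens(7) redp(1), where z = z and w = w]) (use 1 w z redp len red in simp_all)
    from nbases_moves(8)[OF this] show ?thesis using red by simp
  next
    case 2
    have "(winv y \<cdot> x, y) \<in> nbases"
      by (rule step[OF _ _ gens(8) redp(1), where z = z and w = "winv w"]) (use 2 w z redp len red in simp_all)
    from nbases_moves(7)[OF this] show ?thesis using red by simp
  next
    case 3
    have "(x \<cdot> winv y, y) \<in> nbases"
      by (rule step[OF _ _ gens(4) redp(1), where z = "winv z" and w = w]) (use 3 w z redp len red in simp_all)
    from nbases_moves(3)[OF this] show ?thesis using red by simp
  next
    case 4
    have "(x \<cdot> y, y) \<in> nbases"
      by (rule step[OF _ _ gens(3) redp(1), where z = "winv z" and w = "winv w"]) (use 4 w z redp len red in simp_all)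
    from nbases_moves(4)[OF this] show ?thesis using red by simp
  qed
qed

text \<open>Induction on the total length. A pair that neither a Nielsen move nor
  \<open>half_cancel\<close> can shorten satisfies the conditions of \<open>sub_long\<close>. Since
  it generates, every letter is then the image of a single letter, so \<open>x\<close> and
  \<open>y\<close> are letters, and determinant 1 leaves the four rotations of (a, b).\<close>

theorem gen_pair_nbases: "gen_pair x y \<Longrightarrow> (x, y) \<in> nbases"
proof (induction "length x + length y" arbitrary: x y rule: less_induct)
  case less
  have gen: "gen_pair x y" by fact
  then have red: "reduced x" "reduced y" and det: "ca x * cb y - ca y * cb x = 1"
    by (auto simp: gen_pair_def)
  have IH: "(p, q) \<in> nbases" if "gen_pair p q" "length p + length q < length x + length y" for p q
    using less.hyps that by blast
  show ?case
  proof (rule ccontr)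
    assume notin: "(x, y) \<notin> nbases"
    note gens = gen_pair_moves[OF gen]
    \<comment> \<open>A shortening move would put its result into \<open>nbases\<close> by
      induction, and the inverse move would bring back \<open>(x, y)\<close>.\<close>
    have lens: "length y \<le> length (x \<cdot> y)" "length y \<le> length (winv x \<cdot> y)" "length x \<le> length (x \<cdot> y)"
      "length x \<le> length (x \<cdot> winv y)" "length y \<le> length (y \<cdot> x)" "length y \<le> length (y \<cdot> winv x)"
      "length x \<le> length (y \<cdot> x)" "length x \<le> length (winv y \<cdot> x)"
    proof -
      have "(x, x \<cdot> y) \<notin> nbases" "(x, winv x \<cdot> y) \<notin> nbases" "(x \<cdot> y, y) \<notin> nbases"
        "(x \<cdot> winv y, y) \<notin> nbases" "(x, y \<cdot> x) \<notin> nbases" "(x, y \<cdot> winv x) \<notin> nbases"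
        "(y \<cdot> x, y) \<notin> nbases" "(winv y \<cdot> x, y) \<notin> nbases"
        using nbases_moves(2)[of x "x \<cdot> y"] nbases_moves(1)[of x "winv x \<cdot> y"]
          nbases_moves(4)[of "x \<cdot> y" y] nbases_moves(3)[of "x \<cdot> winv y" y]
          nbases_moves(6)[of x "y \<cdot> x"] nbases_moves(5)[of x "y \<cdot> winv x"]
          nbases_moves(8)[of "y \<cdot> x" y] nbases_moves(7)[of "winv y \<cdot> x" y] notin red
        by auto
      then show "length y \<le> length (x \<cdot> y)" "length y \<le> length (winv x \<cdot> y)"
        "length x \<le> length (x \<cdot> y)" "length x \<le> length (x \<cdot> winv y)"
        "length y \<le> length (y \<cdot> x)" "length y \<le> length (y \<cdot> winv x)"
        "length x \<le> length (y \<cdot> x)" "length x \<le> length (winv y \<cdot> x)"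
        using IH[OF gens(1)] IH[OF gens(2)] IH[OF gens(3)] IH[OF gens(4)] IH[OF gens(5)]
          IH[OF gens(6)] IH[OF gens(7)] IH[OF gens(8)] by linarith+
    qed
    let ?I = "img x y"
    let ?c = "\<lambda>l m. cancel (?I l) (?I m)"
    have winv_len: "length (winv u \<cdot> winv v) = length (v \<cdot> u)" if "reduced u" "reduced v" for u v
      using that winv_simps(5)[of "v \<cdot> u"] by simp
    have big: "length (?I l) \<le> length (?I l \<cdot> ?I m) \<and> length (?I m) \<le> length (?I l \<cdot> ?I m)"
      if "m \<noteq> l" "m \<noteq> linv l" for l m
      using that lens red winv_len[of x y] winv_len[of y x] winv_len[of "winv x" y] winv_len[of x "winv y"]
      by (cases l; cases m) auto
    have ne: "?I l \<noteq> []" for l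
      using det by (cases l) auto
    have redI: "reduced (?I l)" for l using red by simp
    have c_le: "2 * ?c l m \<le> length (?I l) \<and> 2 * ?c l m \<le> length (?I m)"
      if "m \<noteq> l" "m \<noteq> linv l" for l m
      using big[OF that] length_mul_cancel[OF redI redI, of l m] by auto
    have c_self: "2 * ?c l l < length (?I l)" for l
      using cancel_self[OF redI ne] .
    have C1: "?c l m < length (?I m)" if "m \<noteq> linv l" for l m
    proof (cases "m = l")
      case False
      have "0 < length (?I m)" using ne by simp
      with c_le[OF False that] show ?thesis by linarith
    qed (use c_self[of l] in simp)
    \<comment> \<open>No neighbour can take more than half of \<open>?I m\<close>, so a failure
      means that both take exactly half. Length alone excludes nothing here, which is why
      \<open>half_cancel\<close> exists.\<close>
    have C2: "?c l m + ?c m n < length (?I m)" if "m \<noteq> linv l" "n \<noteq> linv m" for l m n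
    proof (rule ccontr)
      assume *: "\<not> ?thesis"
      have "2 * ?c l m \<le> length (?I m)" "2 * ?c m n \<le> length (?I m)"
        using c_le[of m l] c_le[of n m] c_self[of m] that by (cases "m = l"; cases "n = m"; auto)+
      then have half: "2 * ?c l m = length (?I m)" "2 * ?c m n = length (?I m)"
        using * by auto
      then have "m \<noteq> l" "n \<noteq> m" using c_self[of m] by auto
      have big_l: "2 * ?c l m \<le> length (?I l)"
        using c_le[of m l] \<open>m \<noteq> l\<close> that by auto
      obtain l' P v' where d1: "?I l = l' @ winv P" "?I m = P @ v'" "length P = ?c l m"
        using cancel_decomp[OF redI redI, of l m] by (metis winv_simps(4,5))
      obtain m' Q n' where d2: "?I m = m' @ winv Q" "?I n = Q @ n'" "length Q = ?c m n"
        using cancel_decomp[OF redI redI, of m n] by (metis winv_simps(4,5))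
      have "length P = length m'" using arg_cong[OF d2(1), of length] d2(3) d1(3) half by simp
      then have m: "?I m = P @ winv Q" using d1(2) d2(1) by simp
      have PQ: "length P = length Q" using d1(3) d2(3) half by simp
      have "P \<noteq> []" using ne[of m] half(1) d1(3) by auto
      \<comment> \<open>Both neighbours of \<open>m\<close> belong to the other generator. Opposite
        ones would give \<open>P = Q\<close>, making \<open>?I m\<close> unreduced; equal ones give
        the shape required by \<open>half_cancel\<close>.\<close>
      have "n = l \<or> n = linv l"
        using \<open>m \<noteq> l\<close> \<open>n \<noteq> m\<close> that by (cases l; cases m; cases n) auto
      then show False
      proof
        assume "n = linv l"
        then have "P @ winv l' = Q @ n'" using d1(1) d2(2) by simp
        then have "P = Q" using PQ by simp
        then show False
          using m redI[of m] not_reduced_append_winv[of P] \<open>P \<noteq> []\<close> by simp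
      next
        assume "n = l"
        have "length Q \<le> length l'"
          using arg_cong[OF d1(1), of length] big_l d1(3) PQ by simp
        moreover have "l' @ winv P = Q @ n'" using d1(1) d2(2) \<open>n = l\<close> by simp
        ultimately obtain z where "l' = Q @ z"
          by (metis append_eq_append_conv_if append_take_drop_id)
        then have l: "?I l = Q @ z @ winv P" using d1(1) by simp
        show False
        proof (cases "l \<in> {La, LA}")
          case True
          then have "?I l \<in> {x, winv x}" "?I m \<in> {y, winv y}"
            using \<open>m \<noteq> l\<close> that by (cases m; auto)+
          from half_cancel[OF gen IH this l m PQ \<open>P \<noteq> []\<close>] notin show False by blast
        next
          case False
          then have "?I l \<in> {y, winv y}" "?I m \<in> {winv x, winv (winv x)}"
            using \<open>m \<noteq> l\<close> that by (cases l; cases m; auto)+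
          \<comment> \<open>The two generators exchange roles by passing to the rotated pair
            \<open>(y, winv x)\<close>.\<close>
          from half_cancel[OF gens(9) IH this l m PQ \<open>P \<noteq> []\<close>] notin nbases_unrot[of y x]
          show False by (simp add: add.commute)
        qed
      qed
    qed
    have single: "\<exists>l. ?I l = [k]" for k
    proof -
      obtain u where "sub x y u = [k]"
        using gen reduced_single[of k] unfolding gen_pair_def by blast
      \<comment> \<open>Multiplying by \<open>[]\<close> on the right reduces \<open>u\<close>
        without changing its image.\<close>
      then have "sub x y (u \<cdot> []) = [k]" by (simp only: sub_mul) simp
      then obtain w where w: "reduced w" "sub x y w = [k]" by (meson reduced_Nil reduced_mul)
      then obtain l w' where w': "w = l # w'" by (cases w) auto
      let ?k = "if w' = [] then 0 else ?c l (hd w')"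
      define t where "t = take (length (?I l) - ?k) (?I l)"
      obtain r where r: "[k] = t @ r" "length w' \<le> length r"
        using sub_long[OF red C1 C2, of l w'] w w' unfolding t_def by auto
      have "?k < length (?I l)"
      proof (cases w')
        case (Cons m w'')
        then have m: "m \<noteq> linv l" using w(1) w' by (auto simp: reduced_Cons)
        show ?thesis
          using c_le[of m l] c_self[of l] m ne[of l] Cons by (cases "m = l") auto
      qed (use ne in auto)
      then have "t \<noteq> []" using ne[of l] by (simp add: t_def)
      then have "r = []"
        using r(1) by (cases t) auto
      then have "w' = []" using r(2) by simp
      then show ?thesis using w w' redI[of l] by auto
    qed
    obtain l m where lm: "?I l = [La]" "?I m = [Lb]" using single by metis
    have "m \<noteq> l" "m \<noteq> linv l"
      using lm by auto
    then have "length x = 1 \<and> length y = 1"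
      using lm by (cases l; cases m) (auto dest!: arg_cong[of _ _ length])
    then obtain i j where "x = [i]" "y = [j]"
      by (auto simp: length_Suc_conv)
    then have "(x, y) \<in> LRbases"
      using det by (intro LRbases.base) (cases i; cases j; simp)
    with notin show False by (blast intro: nbases.LR)
  qed
qed

theorem iso_trivial_abel_inner:
  assumes "\<phi> \<in> iso F2 F2" "abel_mat \<phi> = mat 1"
  shows "\<exists>g. reduced g \<and> (\<forall>w. reduced w \<longrightarrow> \<phi> w = g \<cdot> w \<cdot> winv g)"
proof -
  have hom: "\<phi> \<in> hom F2 F2" using assms by (auto simp: iso_def)
  have red: "reduced (\<phi> [La])" "reduced (\<phi> [Lb])" using hom by (auto simp: hom_def)
  have ab: "ca (\<phi> [La]) = 1" "cb (\<phi> [La]) = 0" "ca (\<phi> [Lb]) = 0" "cb (\<phi> [Lb]) = 1"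
    using assms(2) by (auto simp: abel_mat mats)
  have "\<exists>u. sub (\<phi> [La]) (\<phi> [Lb]) u = w" if "reduced w" for w
  proof -
    have "w \<in> \<phi> ` carrier F2"
      using assms(1) that by (auto simp: iso_def bij_betw_def)
    then obtain v where "reduced v" "\<phi> v = w" by auto
    then show ?thesis using hom_eq_sub[OF hom, of v] by metis
  qed
  then have "gen_pair (\<phi> [La]) (\<phi> [Lb])"
    using red ab by (auto simp: gen_pair_def)
  from nbases_inner[OF gen_pair_nbases[OF this] ab]
  obtain g where g: "reduced g" "\<phi> [La] = g \<cdot> [La] \<cdot> winv g" "\<phi> [Lb] = g \<cdot> [Lb] \<cdot> winv g" by blast
  have "\<phi> w = g \<cdot> w \<cdot> winv g" if "reduced w" for w
    using hom_eq_sub[OF hom that] sub_conj[of "[La]" "[Lb]" g w] g that by simp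
  with g(1) show ?thesis by blast
qed

section \<open>The action on curves\<close>

lemma mem_curve_of:
  "reduced w \<Longrightarrow> u \<in> curve_of w \<longleftrightarrow>
    (\<exists>g. reduced g \<and> (u = g \<cdot> w \<cdot> winv g \<or> u = g \<cdot> winv w \<cdot> winv g))"
  unfolding curve_of_def by force

lemma curve_of_reduced: "reduced w \<Longrightarrow> u \<in> curve_of w \<Longrightarrow> reduced u"
  by (auto simp: mem_curve_of)

lemma curve_of_conj:
  assumes "reduced w" "reduced h"
  shows "curve_of (h \<cdot> w \<cdot> winv h) = curve_of w"
proof -
  have sub: "curve_of (h \<cdot> w \<cdot> winv h) \<subseteq> curve_of w" if red: "reduced w" "reduced h" for w h
  proof
    fix u assume "u \<in> curve_of (h \<cdot> w \<cdot> winv h)"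
    then obtain g where g: "reduced g"
      "u = g \<cdot> (h \<cdot> w \<cdot> winv h) \<cdot> winv g \<or> u = g \<cdot> winv (h \<cdot> w \<cdot> winv h) \<cdot> winv g"
      using red mem_curve_of[of "h \<cdot> w \<cdot> winv h" u] by auto
    then have "u = (g \<cdot> h) \<cdot> w \<cdot> winv (g \<cdot> h) \<or> u = (g \<cdot> h) \<cdot> winv w \<cdot> winv (g \<cdot> h)"
      using red by simp
    then show "u \<in> curve_of w"
      using g(1) red mem_curve_of[OF red(1)] reduced_mul[of h g] by blast
  qed
  have "curve_of w = curve_of (winv h \<cdot> (h \<cdot> w \<cdot> winv h) \<cdot> winv (winv h))"
    using assms by simp
  also have "\<dots> \<subseteq> curve_of (h \<cdot> w \<cdot> winv h)"
    using assms by (intro sub) auto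
  finally show ?thesis using sub[OF assms] by blast
qed

lemma curve_of_iso:
  assumes "\<phi> \<in> iso F2 F2" "reduced w"
  shows "\<phi> ` curve_of w = curve_of (\<phi> w)"
proof -
  have hom: "\<phi> \<in> hom F2 F2" and surj: "\<phi> ` {w. reduced w} = {w. reduced w}"
    using assms by (auto simp: iso_def bij_betw_def)
  have mult: "\<phi> (u \<cdot> v) = \<phi> u \<cdot> \<phi> v" if "reduced u" "reduced v" for u v
    using hom that by (auto simp: hom_def)
  have red: "reduced (\<phi> u)" if "reduced u" for u
    using hom that by (auto simp: hom_def)
  have inv: "\<phi> (winv u) = winv (\<phi> u)" if "reduced u" for u
    using that hom_eq_sub[OF hom, of u] hom_eq_sub[OF hom, of "winv u"] red[of "[La]"] red[of "[Lb]"]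
    by simp
  have conj: "\<phi> (g \<cdot> v \<cdot> winv g) = \<phi> g \<cdot> \<phi> v \<cdot> winv (\<phi> g)" if "reduced g" "reduced v" for g v
    using that by (simp add: mult inv)
  show ?thesis
  proof (intro equalityI subsetI)
    fix u assume "u \<in> \<phi> ` curve_of w"
    then obtain g where g: "reduced g" "u = \<phi> (g \<cdot> w \<cdot> winv g) \<or> u = \<phi> (g \<cdot> winv w \<cdot> winv g)"
      using assms by (auto simp: mem_curve_of)
    then have "u = \<phi> g \<cdot> \<phi> w \<cdot> winv (\<phi> g) \<or> u = \<phi> g \<cdot> winv (\<phi> w) \<cdot> winv (\<phi> g)"
      using assms(2) conj[of g w] conj[of g "winv w"] inv[of w] by simp
    then show "u \<in> curve_of (\<phi> w)"
      using assms(2) red[of w] red[of g] g(1) mem_curve_of[of "\<phi> w" u] by blast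
  next
    fix u assume "u \<in> curve_of (\<phi> w)"
    then obtain h where h: "reduced h" "u = h \<cdot> \<phi> w \<cdot> winv h \<or> u = h \<cdot> winv (\<phi> w) \<cdot> winv h"
      using assms(2) red[of w] mem_curve_of[of "\<phi> w" u] by blast
    have "h \<in> \<phi> ` {w. reduced w}" using surj h(1) by simp
    then obtain g where g: "reduced g" "h = \<phi> g" by auto
    have "u = \<phi> (g \<cdot> w \<cdot> winv g) \<or> u = \<phi> (g \<cdot> winv w \<cdot> winv g)"
      using g h assms(2) conj[of g w] conj[of g "winv w"] inv[of w] by auto
    then show "u \<in> \<phi> ` curve_of w"
      using mem_curve_of[OF assms(2)] g(1) by blast
  qed
qed

text \<open>This resolves the definite description in \<open>mod_act\<close>. For a second
  automorphism \<psi> with the same matrix, \<phi>^-1 \<psi> is trivial on the abelianization, hence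
  inner, and inner automorphisms fix every curve.\<close>

lemma mod_act_iso:
  assumes \<phi>: "\<phi> \<in> iso F2 F2" and w: "reduced w"
  shows "mod_act (abel_mat \<phi>) (curve_of w) = curve_of (\<phi> w)"
  unfolding mod_act_def
proof (rule the_equality)
  show "\<exists>\<psi>\<in>iso F2 F2. abel_mat \<psi> = abel_mat \<phi> \<and> curve_of (\<phi> w) = \<psi> ` curve_of w"
    using curve_of_iso[OF assms] \<phi> by blast
next
  fix \<delta> assume "\<exists>\<psi>\<in>iso F2 F2. abel_mat \<psi> = abel_mat \<phi> \<and> \<delta> = \<psi> ` curve_of w"
  then obtain \<psi> where \<psi>: "\<psi> \<in> iso F2 F2" "abel_mat \<psi> = abel_mat \<phi>" "\<delta> = \<psi> ` curve_of w" by blast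
  have hom: "\<phi> \<in> hom F2 F2" "\<psi> \<in> hom F2 F2" and bij: "bij_betw \<phi> (carrier F2) (carrier F2)"
    using \<phi> \<psi> by (auto simp: iso_def)
  define \<theta> where "\<theta> = inv_into (carrier F2) \<phi>"
  have \<theta>: "\<theta> \<in> iso F2 F2"
    unfolding \<theta>_def using F2.iso_set_sym[OF \<phi>] by simp
  have l: "\<theta> (\<phi> u) = u" "\<phi> (\<theta> u) = u" "reduced (\<theta> u)" if "reduced u" for u
    using that bij_betw_inv_into_left[OF bij, of u] bij_betw_inv_into_right[OF bij, of u] \<theta>
    by (auto simp: \<theta>_def iso_def hom_def)
  have "abel_mat (\<theta> \<circ> \<psi>) = abel_mat (\<theta> \<circ> \<phi>)"
    using \<theta> hom \<psi>(2) by (simp add: abel_mat_comp iso_def)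
  also have "\<dots> = mat 1"
    using l by (simp add: abel_mat mats)
  finally obtain g where g: "reduced g" "\<And>w. reduced w \<Longrightarrow> \<theta> (\<psi> w) = g \<cdot> w \<cdot> winv g"
    using iso_trivial_abel_inner[of "\<theta> \<circ> \<psi>"] iso_set_trans[OF \<psi>(1) \<theta>] by auto
  have "reduced (\<psi> w)" using hom w by (auto simp: hom_def)
  then have "\<psi> w = \<phi> (g \<cdot> w \<cdot> winv g)" using l(2) g(2)[OF w] by metis
  moreover have "g \<cdot> w \<cdot> winv g \<in> curve_of w"
    using g(1) w by (auto simp: mem_curve_of)
  ultimately have "curve_of (\<psi> w) = curve_of (\<phi> (g \<cdot> w \<cdot> winv g))" by simp
  also have "\<dots> = \<phi> ` curve_of w"
    using curve_of_iso[OF \<phi>, of "g \<cdot> w \<cdot> winv g"] curve_of_conj[OF w g(1)] w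
    by (metis reduced_mul reduced_winv g(1))
  also have "\<dots> = curve_of (\<phi> w)" using curve_of_iso[OF assms] .
  finally show "\<delta> = curve_of (\<phi> w)"
    using \<psi> curve_of_iso[OF \<psi>(1) w] by simp
qed

lemma iso_L: "sub [La] [La, Lb] \<in> iso F2 F2" "abel_mat (sub [La] [La, Lb]) = matL"
  by (rule sub_iso[of _ _ "[La]" "[LA, Lb]"]) (auto simp: reduced_Cons abel_mat mats)

lemma iso_R: "sub [La, Lb] [Lb] \<in> iso F2 F2" "abel_mat (sub [La, Lb] [Lb]) = matR"
  by (rule sub_iso[of _ _ "[La, LB]" "[Lb]"]) (auto simp: reduced_Cons abel_mat mats)

lemma iso_S: "sub [Lb] [LA] \<in> iso F2 F2" "abel_mat (sub [Lb] [LA]) = matS"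
  by (rule sub_iso[of _ _ "[LB]" "[La]"]) (auto simp: reduced_Cons abel_mat mats)

section \<open>The positive monoid and the quadrants of columns\<close>

lemma LR_monoid_nonneg:
  "M \<in> LR_monoid \<Longrightarrow> det M = 1 \<and> 0 \<le> M$1$1 \<and> 0 \<le> M$1$2 \<and> 0 \<le> M$2$1 \<and> 0 \<le> M$2$2"
proof (induction rule: LR_monoid.induct)
  case (L M)
  then show ?case by (cases M rule: mat2_cases) (auto simp: mats algebra_simps)
next
  case (R M)
  then show ?case by (cases M rule: mat2_cases) (auto simp: mats algebra_simps)
qed (auto simp: mats)

text \<open>Euclid's algorithm on the rows: when one row dominates the other, subtracting the
  smaller strips off a factor \<open>matL\<close> or \<open>matR\<close>. For nonnegative entries
  and determinant 1, incomparable rows occur only in the identity.\<close>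

lemma nonneg_LR_monoid:
  "0 \<le> p \<Longrightarrow> 0 \<le> q \<Longrightarrow> 0 \<le> r \<Longrightarrow> 0 \<le> s \<Longrightarrow> p * s - q * r = 1 \<Longrightarrow> mat2 p q r s \<in> LR_monoid"
proof (induction "nat (p + q + r + s)" arbitrary: p q r s rule: less_induct)
  case less
  consider "q = 0" "r = 0" | "r \<le> p" "s \<le> q" "r + s > 0" | "p \<le> r" "q \<le> s" "p + q > 0"
  proof -
    have 1: "q = 0 \<and> r = 0" if "r < p" "q < s"
    proof -
      have "(r + 1) * (q + 1) \<le> p * s" using \<open>r < p\<close> \<open>q < s\<close> less.prems by (intro mult_mono) auto
      then have "r + q \<le> 0" using less.prems(5) by (simp add: algebra_simps)
      then show ?thesis using less.prems by auto
    qed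
    have 2: False if "p < r" "s < q"
      using mult_mono[of p r s q] \<open>p < r\<close> \<open>s < q\<close> less.prems by (simp add: algebra_simps)
    have "r + s > 0" "p + q > 0"
      using less.prems by (smt (verit) mult_not_zero)+
    then have "q = 0 \<and> r = 0 \<or> r \<le> p \<and> s \<le> q \<and> r + s > 0 \<or> p \<le> r \<and> q \<le> s \<and> p + q > 0"
      using 1 2 by (cases "r < p"; cases "q < s"; cases "p < r"; cases "s < q") auto
    then show ?thesis using that by blast
  qed
  then show ?case
  proof cases
    case 1
    then have "p * s = 1" using less.prems by simp
    then have "p = 1" "s = 1" using less.prems by (auto simp: zmult_eq_1_iff)
    then show ?thesis using 1 LR_monoid.one by (simp add: mats)
  next
    case 2
    have "mat2 (p - r) (q - s) r s \<in> LR_monoid"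
      using 2 less.prems by (intro less.hyps) (auto simp: algebra_simps)
    from LR_monoid.L[OF this] show ?thesis by (simp add: mats)
  next
    case 3
    have "mat2 p q (r - p) (s - q) \<in> LR_monoid"
      using 3 less.prems by (intro less.hyps) (auto simp: algebra_simps)
    from LR_monoid.R[OF this] show ?thesis by (simp add: mats)
  qed
qed

text \<open>The matrices \<open>M\<close> and \<open>M ** matS\<close> with \<open>M \<in> LR_monoid\<close>, recognized by their columns.\<close>

definition quad :: "int^2^2 \<Rightarrow> bool" where
  "quad M \<longleftrightarrow> det M = 1 \<and> 0 \<le> M$1$1 \<and> 0 \<le> M$2$1 \<and>
     (0 \<le> M$1$2 \<and> 0 \<le> M$2$2 \<or> M$1$2 \<le> 0 \<and> M$2$2 \<le> 0)"

lemma quad_mat2: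
  "quad (mat2 a b c d) \<longleftrightarrow> a * d - b * c = 1 \<and> 0 \<le> a \<and> 0 \<le> c \<and> (0 \<le> b \<and> 0 \<le> d \<or> b \<le> 0 \<and> d \<le> 0)"
  by (simp add: quad_def)

text \<open>If \<open>N\<close> has columns u, v, then \<open>N ** matS\<close> has columns v, -u,
  which is the second sign pattern of \<open>quad\<close>.\<close>

lemma quad_iff: "quad M \<longleftrightarrow> M \<in> LR_monoid \<or> M \<in> (\<lambda>N. N ** matS) ` LR_monoid"
proof
  obtain a b c d where M: "M = mat2 a b c d" by (rule mat2_cases)
  assume "quad M"
  then consider "a * d - b * c = 1" "0 \<le> a" "0 \<le> c" "0 \<le> b" "0 \<le> d"
    | "a * d - b * c = 1" "0 \<le> a" "0 \<le> c" "b \<le> 0" "d \<le> 0"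
    by (auto simp: M quad_mat2)
  then show "M \<in> LR_monoid \<or> M \<in> (\<lambda>N. N ** matS) ` LR_monoid"
  proof cases
    case 1
    then show ?thesis using M nonneg_LR_monoid[of a b c d] by simp
  next
    case 2
    then have "mat2 (-b) a (-d) c \<in> LR_monoid"
      by (intro nonneg_LR_monoid) (auto simp: algebra_simps)
    moreover have "M = mat2 (-b) a (-d) c ** matS" by (simp add: M mats)
    ultimately show ?thesis by blast
  qed
next
  assume "M \<in> LR_monoid \<or> M \<in> (\<lambda>N. N ** matS) ` LR_monoid"
  then show "quad M"
  proof
    assume "M \<in> LR_monoid"
    then show ?thesis using LR_monoid_nonneg by (auto simp: quad_def)
  next
    assume "M \<in> (\<lambda>N. N ** matS) ` LR_monoid"
    then obtain N where N: "N \<in> LR_monoid" "M = N ** matS" by blast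
    then show ?thesis
      using LR_monoid_nonneg[OF N(1)]
      by (cases N rule: mat2_cases) (auto simp: mats quad_mat2 algebra_simps)
  qed
qed

lemma matS_pow:
  "matS [^]\<^bsub>SL2Z\<^esub> (0::nat) = mat2 1 0 0 1" "matS [^]\<^bsub>SL2Z\<^esub> (1::nat) = mat2 0 (-1) 1 0"
  "matS [^]\<^bsub>SL2Z\<^esub> (2::nat) = mat2 (-1) 0 0 (-1)" "matS [^]\<^bsub>SL2Z\<^esub> (3::nat) = mat2 0 1 (-1) 0"
  "matS [^]\<^bsub>SL2Z\<^esub> Suc 0 = mat2 0 (-1) 1 0"
  by (simp_all add: mats nat_pow_def numeral_2_eq_2 numeral_3_eq_3)

lemma SL2Z_rotate_quad:
  assumes "det M = 1"
  shows "\<exists>k\<in>{0, 1, 2, 3::nat}. quad (matS [^]\<^bsub>SL2Z\<^esub> k ** M)"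
proof -
  obtain a b c d where M: "M = mat2 a b c d" by (rule mat2_cases)
  \<comment> \<open>With the first column strictly inside the first quadrant, determinant 1 rules
    out mixed signs in the second column. A first column on an axis may require one more quarter
    turn, in either direction.\<close>
  have *: "quad (mat2 a b c d) \<or> quad (mat2 (-c) (-d) a b) \<or> quad (mat2 c d (-a) (-b))"
    if abcd: "a * d - b * c = 1" "0 \<le> a" "0 \<le> c" for a b c d :: int
  proof -
    consider "a = 0" | "c = 0" | "a > 0" "c > 0" using abcd(2,3) by linarith
    then show ?thesis
    proof cases
      case 1
      then have "b * c = -1" using abcd by simp
      then have "c = 1" "b = -1" using abcd by (auto simp: zmult_eq_neg1_iff)
      then show ?thesis using 1 by (auto simp: quad_mat2)
    next
      case 2
      then have "a = 1" "d = 1" using abcd by (auto simp: zmult_eq_1_iff)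
      then show ?thesis using 2 by (auto simp: quad_mat2)
    next
      case 3
      have False if "b > 0" "d < 0"
        using mult_pos_pos[OF that(1) 3(2)] mult_pos_neg[OF 3(1) that(2)] \<open>a * d - b * c = 1\<close> by linarith
      moreover have False if "b < 0" "d > 0"
        using mult_neg_pos[OF that(1) 3(2)] mult_pos_pos[OF 3(1) that(2)] \<open>a * d - b * c = 1\<close> by linarith
      ultimately show ?thesis using abcd by (auto simp: quad_mat2)
    qed
  qed
  have det: "a * d - b * c = 1" using assms M by simp
  consider "0 \<le> a" "0 \<le> c" | "a \<le> 0" "0 \<le> c" | "a \<le> 0" "c \<le> 0" | "0 \<le> a" "c \<le> 0" by linarith
  then have "quad (mat2 a b c d) \<or> quad (mat2 (-c) (-d) a b) \<or> quad (mat2 (-a) (-b) (-c) (-d))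
      \<or> quad (mat2 c d (-a) (-b))"
    using *[of a d b c] *[of c "-b" d "-a"] *[of "-a" "-d" "-b" "-c"] *[of "-c" b "-d" a] det
    by cases (auto simp: algebra_simps)
  then show ?thesis by (simp add: M matS_pow) (simp add: mats)
qed

text \<open>Realizable matrices are closed under products and contain \<open>matL\<close>,
  \<open>matR\<close>, \<open>matS\<close>; by \<open>SL2Z_rotate_quad\<close> these generate
  everything.\<close>

lemma SL2Z_iso:
  assumes "det M = 1"
  shows "\<exists>\<phi>\<in>iso F2 F2. abel_mat \<phi> = M"
proof -
  define G where "G = abel_mat ` iso F2 F2"
  have mult: "M ** N \<in> G" if "M \<in> G" "N \<in> G" for M N
  proof -
    from that obtain \<phi> \<psi> where "\<phi> \<in> iso F2 F2" "\<psi> \<in> iso F2 F2" "M = abel_mat \<phi>" "N = abel_mat \<psi>"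
      by (auto simp: G_def)
    moreover from this have "M ** N = abel_mat (\<phi> \<circ> \<psi>)"
      using abel_mat_comp[of \<phi> \<psi>] by (simp add: iso_def)
    ultimately show ?thesis
      unfolding G_def using iso_set_trans[of \<psi> F2 F2 \<phi> F2] by blast
  qed
  have gens: "matL \<in> G" "matR \<in> G" "matS \<in> G"
    using iso_L iso_R iso_S unfolding G_def by (metis imageI)+
  have "N \<in> G" if "N \<in> LR_monoid" for N
    using that
  proof induction
    case one
    have "matS ** (matS ** (matS ** matS)) = matI" by (simp add: mats)
    then show ?case using gens mult by metis
  qed (use gens mult in auto)
  then have quad: "N \<in> G" if "quad N" for N
    using that gens mult by (auto simp: quad_iff)
  obtain k :: nat where k: "k \<in> {0, 1, 2, 3}" "quad (matS [^]\<^bsub>SL2Z\<^esub> k ** M)"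
    using SL2Z_rotate_quad[OF assms] by blast
  have "mat2 1 0 0 1 \<in> G" by (rule quad) (simp add: quad_mat2)
  moreover have "mat2 0 (-1) 1 0 \<in> G" using gens(3) by (simp add: mats)
  moreover have "mat2 (-1) 0 0 (-1) \<in> G" using mult[OF gens(3,3)] by (simp add: mats)
  moreover have "mat2 0 1 (-1) 0 \<in> G" using mult[OF gens(3) mult[OF gens(3,3)]] by (simp add: mats)
  ultimately have G: "N \<in> G" if "N \<in> {mat2 1 0 0 1, mat2 0 1 (-1) 0, mat2 (-1) 0 0 (-1), mat2 0 (-1) 1 0}" for N
    using that by blast
  have "\<exists>N\<in>{mat2 1 0 0 1, mat2 0 1 (-1) 0, mat2 (-1) 0 0 (-1), mat2 0 (-1) 1 0}.
      N ** (matS [^]\<^bsub>SL2Z\<^esub> k) = mat 1"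
    using k(1) by (elim insertE emptyE) (simp_all only: matS_pow, simp_all add: mats)
  then obtain N where N: "N \<in> {mat2 1 0 0 1, mat2 0 1 (-1) 0, mat2 (-1) 0 0 (-1), mat2 0 (-1) 1 0}"
    "N ** (matS [^]\<^bsub>SL2Z\<^esub> k) = mat 1" by blast
  have "N ** (matS [^]\<^bsub>SL2Z\<^esub> k ** M) = (N ** matS [^]\<^bsub>SL2Z\<^esub> k) ** M"
    by (rule matrix_mul_assoc)
  also have "\<dots> = M" using N(2) by simp
  finally have "M \<in> G" using mult[OF G[OF N(1)] quad[OF k(2)]] by simp
  then show ?thesis by (auto simp: G_def)
qed

section \<open>The group action on curves and the trees\<close>

lemma curves_cases:
  assumes "\<gamma> \<in> curves" obtains w where "reduced w" "\<gamma> = curve_of w"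
  using assms by (auto simp: curves_def)

lemma mod_act_closed:
  assumes "det M = 1" "\<gamma> \<in> curves"
  shows "mod_act M \<gamma> \<in> curves"
proof -
  obtain w where w: "reduced w" "\<gamma> = curve_of w" using assms(2) by (rule curves_cases)
  obtain \<phi> where \<phi>: "\<phi> \<in> iso F2 F2" "abel_mat \<phi> = M" using SL2Z_iso[OF assms(1)] by blast
  then show ?thesis
    using mod_act_iso[OF \<phi>(1) w(1)] w by (auto simp: curves_def iso_def hom_def)
qed

lemma mod_act_mult:
  assumes "det M = 1" "det N = 1" "\<gamma> \<in> curves"
  shows "mod_act (M ** N) \<gamma> = mod_act M (mod_act N \<gamma>)"
proof -
  obtain w where w: "reduced w" "\<gamma> = curve_of w" using assms(3) by (rule curves_cases)
  obtain \<phi> where \<phi>: "\<phi> \<in> iso F2 F2" "abel_mat \<phi> = M" using SL2Z_iso[OF assms(1)] by blast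
  obtain \<psi> where \<psi>: "\<psi> \<in> iso F2 F2" "abel_mat \<psi> = N" using SL2Z_iso[OF assms(2)] by blast
  have "reduced (\<psi> w)" using \<psi> w by (auto simp: iso_def hom_def)
  moreover have "abel_mat (\<phi> \<circ> \<psi>) = M ** N"
    using \<phi> \<psi> abel_mat_comp by (auto simp: iso_def)
  ultimately show ?thesis
    using mod_act_iso[OF \<phi>(1)] mod_act_iso[OF \<psi>(1) w(1)] mod_act_iso[OF iso_set_trans[OF \<psi>(1) \<phi>(1)] w(1)]
      \<phi> \<psi> w by simp
qed

lemma mod_act_one:
  assumes "\<gamma> \<in> curves"
  shows "mod_act (mat 1) \<gamma> = \<gamma>"
proof -
  obtain w where w: "reduced w" "\<gamma> = curve_of w" using assms by (rule curves_cases)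
  have "sub [La] [Lb] \<in> iso F2 F2"
    by (rule sub_iso[of _ _ "[La]" "[Lb]"]) auto
  moreover have "abel_mat (sub [La] [Lb]) = mat 1" by (simp add: abel_mat mats)
  ultimately show ?thesis using mod_act_iso[of "sub [La] [Lb]" w] w by simp
qed

lemma tree_Un:
  assumes "\<gamma> \<in> curves"
  shows "tree \<gamma> \<union> tree (mod_act matS \<gamma>) = (\<lambda>M. mod_act M \<gamma>) ` {M. quad M}"
proof -
  have "det matS = 1" by (simp add: mats)
  then have "mod_act N (mod_act matS \<gamma>) = mod_act (N ** matS) \<gamma>" if "N \<in> LR_monoid" for N
    using that LR_monoid_nonneg assms by (simp add: mod_act_mult)
  then have "tree (mod_act matS \<gamma>) = (\<lambda>M. mod_act M \<gamma>) ` (\<lambda>N. N ** matS) ` LR_monoid"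
    unfolding tree_def by (auto simp: image_image)
  moreover have "{M. quad M} = LR_monoid \<union> (\<lambda>N. N ** matS) ` LR_monoid"
    using quad_iff by blast
  ultimately show ?thesis unfolding tree_def by (simp only: image_Un)
qed

section \<open>The quarter turn as a renaming of letters\<close>

fun rotl :: "letter \<Rightarrow> letter" where
  "rotl La = Lb" | "rotl Lb = LA" | "rotl LA = LB" | "rotl LB = La"

lemma rotl_linv [simp]: "rotl (linv x) = linv (rotl x)" and rotl_eq [simp]: "rotl x = rotl y \<longleftrightarrow> x = y"
  by (cases x; simp) (cases x; cases y; simp)

lemma rotl_eq_linv [simp]: "rotl x = linv (rotl y) \<longleftrightarrow> x = linv y"
  using rotl_eq[of x "linv y"] by (simp del: rotl_eq)

lemma reduced_map_rotl [simp]: "reduced (map rotl w) \<longleftrightarrow> reduced w"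
  by (induction w) (auto simp: reduced_Cons hd_map)

lemma sub_rotl: "reduced w \<Longrightarrow> sub [Lb] [LA] w = map rotl w"
proof (induction w)
  case (Cons l w)
  have "img [Lb] [LA] l = [rotl l]" by (cases l) auto
  moreover have "reduced (rotl l # map rotl w)"
    using reduced_map_rotl[of "l # w"] Cons.prems by simp
  ultimately show ?case using Cons by (simp add: reduced_Cons lcons_reduced)
qed simp

lemma curve_length_S:
  assumes "\<gamma> \<in> curves"
  shows "curve_length (mod_act matS \<gamma>) = curve_length \<gamma>"
proof -
  obtain w where w: "reduced w" "\<gamma> = curve_of w" using assms by (rule curves_cases)
  have "mod_act matS \<gamma> = sub [Lb] [LA] ` \<gamma>"
    using mod_act_iso[OF iso_S(1) w(1)] curve_of_iso[OF iso_S(1) w(1)] iso_S(2) w(2) by simp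
  also have "\<dots> = map rotl ` \<gamma>"
    using curve_of_reduced[OF w(1)] w(2) by (intro image_cong) (auto simp: sub_rotl)
  finally have "mod_act matS \<gamma> = map rotl ` \<gamma>" .
  moreover have "cyclically_reduced (map rotl w) \<longleftrightarrow> cyclically_reduced w" for w
    by (cases "w = []") (simp_all add: cyclically_reduced_def last_map hd_map)
  ultimately show ?thesis by (simp add: curve_length_def)
qed

section \<open>Dehn twist orbits\<close>

primrec gpow :: "nat \<Rightarrow> word \<Rightarrow> word" where
  "gpow 0 w = []" | "gpow (Suc k) w = w \<cdot> gpow k w"

lemma reduced_gpow [simp]: "reduced (gpow k w)"
  by (induction k) auto

lemma gpow_conj: "reduced w \<Longrightarrow> reduced g \<Longrightarrow> gpow k (g \<cdot> w \<cdot> winv g) = g \<cdot> gpow k w \<cdot> winv g"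
  by (induction k) auto

lemma length_gpow_le: "length (gpow k w) \<le> k * length w"
proof (induction k)
  case (Suc k)
  then show ?case using length_mul[of w "gpow k w"] by simp
qed simp

lemma length_gpow_cyclically_reduced:
  assumes "cyclically_reduced w"
  shows "length (gpow k w) = k * length w"
proof (cases "w = []")
  case False
  have "gpow k w = concat (replicate k w) \<and> reduced (concat (replicate k w))"
  proof (induction k)
    case (Suc k)
    have "reduced (w @ concat (replicate k w))"
      using Suc assms False by (cases k) (auto simp: reduced_append cyclically_reduced_def)
    with Suc show ?case by (simp add: mul_eq_append)
  qed simp
  then show ?thesis by (simp add: length_concat sum_list_replicate)
qed (induction k; simp)

text \<open>Compare the lengths of the \<open>k\<close>-th powers for large \<open>k\<close>.\<close>

lemma cyclically_reduced_conj_le: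
  assumes "cyclically_reduced (g \<cdot> v \<cdot> winv g)" "reduced v" "reduced g"
  shows "length (g \<cdot> v \<cdot> winv g) \<le> length v"
proof (rule ccontr)
  let ?w = "g \<cdot> v \<cdot> winv g"
  \<comment> \<open>Conjugation by \<open>g\<close> adds at most \<open>2 * length g\<close> letters
    to a power, while each factor of a longer \<open>?w\<close> contributes at least one letter more
    than \<open>v\<close>; this exponent is the first for which the latter wins.\<close>
  define k where "k = 2 * length g + 1"
  assume "\<not> ?thesis"
  then have "k * (length v + 1) \<le> k * length ?w" by (intro mult_le_mono2) simp
  also have "\<dots> = length (gpow k ?w)"
    by (rule length_gpow_cyclically_reduced[OF assms(1), symmetric])
  also have "gpow k ?w = g \<cdot> gpow k v \<cdot> winv g"
    by (rule gpow_conj[OF assms(2,3)])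
  also have "length \<dots> \<le> length g + (length (gpow k v) + length g)"
    using length_mul[of g "gpow k v \<cdot> winv g"] length_mul[of "gpow k v" "winv g"] by simp
  also have "\<dots> \<le> 2 * length g + k * length v"
    using length_gpow_le[of k v] by simp
  finally show False by (simp add: k_def)
qed

lemma cyclically_reduced_curve_le:
  assumes "cyclically_reduced u" "u \<in> curve_of v" "reduced v"
  shows "length u \<le> length v"
  using assms cyclically_reduced_conj_le[of _ v] cyclically_reduced_conj_le[of _ "winv v"]
  by (auto simp: mem_curve_of)

lemma curve_of_self: "reduced w \<Longrightarrow> w \<in> curve_of w"
  by (auto simp: mem_curve_of intro!: exI[of _ "[]"])

lemma curve_of_mul_commute:
  assumes "reduced u" "reduced v"
  shows "curve_of (u \<cdot> v) = curve_of (v \<cdot> u)"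
  using curve_of_conj[of "u \<cdot> v" "winv u"] assms by simp

section \<open>Powers of a, and words cut at the letters b and B\<close>

definition apow :: "int \<Rightarrow> word" where
  "apow n = (if n \<ge> 0 then replicate (nat n) La else replicate (nat (- n)) LA)"

lemma reduced_replicate: "x \<noteq> linv x \<Longrightarrow> reduced (replicate n x)"
  by (induction n) (auto simp: reduced_Cons)

lemma reduced_apow [simp]: "reduced (apow n)"
  by (simp add: apow_def reduced_replicate)

lemma length_apow [simp]: "length (apow n) = nat \<bar>n\<bar>"
  by (simp add: apow_def)

lemma apow_0 [simp]: "apow 0 = []"
  by (simp add: apow_def)

lemma apow_eq_Nil [simp]: "apow n = [] \<longleftrightarrow> n = 0"
  by (simp add: apow_def)

lemma set_apow: "set (apow n) \<subseteq> {La, LA}"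
  by (auto simp: apow_def)

lemma apow_int: "apow (int k) = replicate k La" "apow (- int k) = replicate k LA"
  by (auto simp: apow_def)

lemma lcons_apow: "lcons La (apow n) = apow (n + 1)" "lcons LA (apow n) = apow (n - 1)"
proof -
  have [simp]: "lcons x (replicate k x) = x # replicate k x" for k x
    by (cases k) auto
  consider k where "n = int k" | k where "n = - int k"
    by (metis int_cases2)
  then have "lcons La (apow n) = apow (n + 1) \<and> lcons LA (apow n) = apow (n - 1)"
  proof cases
    case (1 k)
    have "apow (n + 1) = replicate (Suc k) La"
      using apow_int(1)[of "Suc k"] 1 by (simp add: add.commute)
    moreover have "lcons LA (apow n) = apow (n - 1)"
    proof (cases k)
      case 0
      then show ?thesis using 1 apow_int(2)[of 1] by simp
    next
      case (Suc i)
      then have "n - 1 = int i" using 1 by simp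
      then show ?thesis using Suc 1 apow_int(1)[of k] apow_int(1)[of i] by simp
    qed
    ultimately show ?thesis using 1 apow_int(1) by simp
  next
    case (2 k)
    have "- int (Suc k) = n - 1" using 2 by simp
    then have "apow (n - 1) = replicate (Suc k) LA"
      using apow_int(2)[of "Suc k"] by simp
    moreover have "lcons La (apow n) = apow (n + 1)"
    proof (cases k)
      case 0
      then show ?thesis using 2 apow_int(1)[of 1] by simp
    next
      case (Suc i)
      then have "n + 1 = - int i" using 2 by simp
      then show ?thesis using Suc 2 apow_int(2)[of k] apow_int(2)[of i] by simp
    qed
    ultimately show ?thesis using 2 apow_int(2) by simp
  qed
  then show "lcons La (apow n) = apow (n + 1)" "lcons LA (apow n) = apow (n - 1)" by auto
qed

lemma apow_add: "apow m \<cdot> apow n = apow (m + n)"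
proof -
  have "foldr lcons (replicate k La) (apow n) = apow (int k + n)"
    "foldr lcons (replicate k LA) (apow n) = apow (- int k + n)" for k
    by (induction k) (auto simp: lcons_apow algebra_simps)
  from this[of "nat m"] this[of "nat (- m)"] show ?thesis
    by (auto simp: apow_def[of m] add.commute)
qed

lemma apow_add_left [simp]: "reduced v \<Longrightarrow> apow m \<cdot> apow n \<cdot> v = apow (m + n) \<cdot> v"
  using mul_assoc[of "apow n" v "apow m"] by (simp add: apow_add)

lemma winv_apow [simp]: "winv (apow n) = apow (- n)"
  by (auto simp: winv_def apow_def)

lemma ca_apow [simp]: "ca (apow n) = n" "cb (apow n) = 0"
proof -
  have "count_list (replicate k x) y = (if x = y then k else 0)" for k and x y :: letter
    by (induction k) auto
  then show "ca (apow n) = n" "cb (apow n) = 0" by (auto simp: ca_def cb_def apow_def)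
qed

lemma sub_apow [simp]: "sub [La] y (apow n) = apow n"
proof -
  have [simp]: "lcons x (replicate k x) = x # replicate k x" for k x
    by (cases k) auto
  have "sub [La] y (replicate k La) = replicate k La" "sub [La] y (replicate k LA) = replicate k LA" for k
    by (induction k) auto
  then show ?thesis by (auto simp: apow_def)
qed

definition bl :: "bool \<Rightarrow> letter" where
  "bl e = (if e then Lb else LB)"

lemma bl_simps [simp]:
  "bl e = bl e' \<longleftrightarrow> e = e'" "linv (bl e) = bl (\<not> e)" "bl e \<notin> {La, LA}" "bl e \<noteq> La" "bl e \<noteq> LA" "La \<noteq> bl e" "LA \<noteq> bl e"
  by (auto simp: bl_def)

text \<open>A list of pairs \<open>(e, n)\<close> stands for the product of the \<open>b\<^sup>e a\<^sup>n\<close>, where \<open>True\<close> means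
  exponent \<open>1\<close> and \<open>False\<close> exponent \<open>-1\<close>.\<close>

primrec wd :: "(bool \<times> int) list \<Rightarrow> word" where
  "wd [] = []" | "wd (p # xs) = bl (fst p) # apow (snd p) @ wd xs"

text \<open>The group product, as opposed to the literal word \<open>wd\<close>; the two agree on
  admissible lists by \<open>syl_eq_wd\<close>.\<close>

primrec syl :: "(bool \<times> int) list \<Rightarrow> word" where
  "syl [] = []" | "syl (p # xs) = [bl (fst p)] \<cdot> apow (snd p) \<cdot> syl xs"

text \<open>The sign of the b-letter that comes next, where \<open>e0\<close> stands for the one
  after the end. Taking \<open>e0\<close> to be the sign of the first pair closes the list to a
  cyclic word.\<close>

fun nxt :: "bool \<Rightarrow> (bool \<times> int) list \<Rightarrow> bool" where
  "nxt e0 [] = e0" | "nxt e0 (p # xs) = fst p"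

text \<open>Only a vanishing exponent between opposite letters b and B would allow a
  cancellation.\<close>

primrec adm :: "bool \<Rightarrow> (bool \<times> int) list \<Rightarrow> bool" where
  "adm e0 [] = True"
| "adm e0 (p # xs) = ((fst p \<noteq> nxt e0 xs \<longrightarrow> snd p \<noteq> 0) \<and> adm e0 xs)"

text \<open>The twist sends b to a^k b and B to B a^-k. So an exponent of a gains k from a letter b
  on its right and loses k to a letter B on its left; between opposite letters the total is
  0.\<close>

definition gap :: "bool \<Rightarrow> bool \<Rightarrow> int" where
  "gap e e' = of_bool e' - of_bool (\<not> e)"

primrec shift :: "int \<Rightarrow> bool \<Rightarrow> (bool \<times> int) list \<Rightarrow> (bool \<times> int) list" where
  "shift k e0 [] = []"
| "shift k e0 (p # xs) = (fst p, snd p + k * gap (fst p) (nxt e0 xs)) # shift k e0 xs"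

lemma nxt_shift [simp]: "nxt e0 (shift k e0 xs) = nxt e0 xs"
  by (cases xs) auto

lemma gap_eq_0 [simp]: "gap e e' = 0 \<longleftrightarrow> e \<noteq> e'"
  by (auto simp: gap_def)

lemma adm_shift: "adm e0 xs \<Longrightarrow> adm e0 (shift k e0 xs)"
proof (induction xs)
  case (Cons p xs)
  then show ?case by (auto simp: gap_def)
qed simp

lemma reduced_syl [simp]: "reduced (syl xs)"
  by (induction xs) (auto simp: reduced_lcons)

lemma syl_append: "syl (xs @ ys) = syl xs \<cdot> syl ys"
  by (induction xs) (auto simp del: foldr_Cons)

lemma hd_wd: "hd (wd xs @ [bl e0]) = bl (nxt e0 xs)"
  by (cases xs) auto

lemma reduced_wd: "adm e0 xs \<Longrightarrow> reduced (wd xs @ [bl e0])"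
proof (induction xs)
  case (Cons p xs)
  have r: "reduced (wd xs @ [bl e0])" and a: "fst p \<noteq> nxt e0 xs \<longrightarrow> snd p \<noteq> 0"
    using Cons by auto
  have "reduced (apow (snd p) @ wd xs @ [bl e0])"
    unfolding reduced_append[of "apow _"]
  proof (intro conjI impI r reduced_apow)
    assume "apow (snd p) \<noteq> [] \<and> wd xs @ [bl e0] \<noteq> []"
    then have "last (apow (snd p)) \<in> {La, LA}"
      using set_apow[of "snd p"] last_in_set by blast
    then show "hd (wd xs @ [bl e0]) \<noteq> linv (last (apow (snd p)))"
      unfolding hd_wd by auto
  qed
  moreover have "hd (apow (snd p) @ wd xs @ [bl e0]) \<noteq> linv (bl (fst p))"
  proof (cases "snd p = 0")
    case True
    then show ?thesis using a hd_wd[of xs e0] by auto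
  next
    case False
    then have "hd (apow (snd p)) \<in> {La, LA}"
      using set_apow[of "snd p"] hd_in_set[of "apow (snd p)"] by (metis apow_eq_Nil subsetD)
    with False show ?thesis by auto
  qed
  ultimately show ?case by (simp add: reduced_Cons)
qed simp

lemma syl_eq_wd: "adm e0 xs \<Longrightarrow> syl xs = wd xs"
proof (induction xs)
  case (Cons p xs)
  have "reduced (wd (p # xs))"
    using reduced_wd[OF Cons.prems] unfolding reduced_append[of _ "[_]"] by blast
  then have "reduced (bl (fst p) # apow (snd p) @ wd xs)" by simp
  moreover from this have "reduced (apow (snd p) @ wd xs)" by (simp add: reduced_Cons)
  ultimately show ?case using Cons by (simp add: mul_eq_append lcons_reduced)
qed simp

lemma cyclically_reduced_wd:
  assumes "adm (fst (hd xs)) xs" "xs \<noteq> []"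
  shows "cyclically_reduced (wd xs)"
proof -
  obtain p ys where xs: "xs = p # ys" using assms(2) by (cases xs) auto
  have ne: "wd xs \<noteq> []" and h: "hd (wd xs) = bl (fst (hd xs))" by (auto simp: xs)
  have "bl (fst (hd xs)) \<noteq> linv (last (wd xs))" "reduced (wd xs)"
    using reduced_wd[OF assms(1)] ne unfolding reduced_append[of _ "[_]"] by auto
  then show ?thesis using h by (simp add: cyclically_reduced_def)
qed

text \<open>A single nonzero \<open>gap\<close> suffices for growth: the exponent n there becomes n
  + k or n - k, of absolute value at least k - |n|.\<close>

lemma shift_fixed_or_grows:
  "(\<forall>k. shift k e0 xs = xs) \<or> (\<exists>C. \<forall>k. k \<le> length (wd (shift (int k) e0 xs)) + C)"
proof (induction xs)
  case (Cons p xs)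
  show ?case
  proof (cases "fst p = nxt e0 xs")
    case True
    have "k \<le> length (wd (shift (int k) e0 (p # xs))) + nat \<bar>snd p\<bar>" for k
      using True by (cases "nxt e0 xs") (auto simp: gap_def)
    then show ?thesis by blast
  next
    case False
    then have g: "gap (fst p) (nxt e0 xs) = 0" by simp
    from Cons.IH show ?thesis
    proof
      assume "\<exists>C. \<forall>k. k \<le> length (wd (shift (int k) e0 xs)) + C"
      then obtain C where C: "k \<le> length (wd (shift (int k) e0 xs)) + C" for k by blast
      have "k \<le> length (wd (shift (int k) e0 (p # xs))) + C" for k
        using C[of k] by simp
      then show ?thesis by blast
    qed (simp add: g)
  qed
qed simp

abbreviation twist :: "int \<Rightarrow> word \<Rightarrow> word" where
  "twist k \<equiv> sub [La] (apow k \<cdot> [Lb])"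

lemma twist_iso: "twist k \<in> iso F2 F2" "abel_mat (twist k) = mat2 1 k 0 1"
proof -
  show "twist k \<in> iso F2 F2"
    by (rule sub_iso[of _ _ "[La]" "apow (- k) \<cdot> [Lb]"]) (auto simp del: foldr_Cons)
  show "abel_mat (twist k) = mat2 1 k 0 1"
    by (simp add: abel_mat)
qed

lemma twist_bl:
  "img [La] (apow k \<cdot> [Lb]) (bl e) = apow (k * of_bool e) \<cdot> [bl e] \<cdot> apow (- k * of_bool (\<not> e))"
  by (cases e) (auto simp: bl_def)

text \<open>The trailing power is the contribution of the letter b that may follow the end, and it
  lets the induction close. When \<open>e0\<close> is the sign of the first letter, the same power
  appears on both sides and becomes a conjugation in \<open>curve_twist_syl\<close>.\<close>

lemma twist_syl:
  "twist k (syl xs) \<cdot> apow (k * of_bool e0) = apow (k * of_bool (nxt e0 xs)) \<cdot> syl (shift k e0 xs)"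
proof (induction xs)
  case (Cons p xs)
  let ?e = "fst p" and ?s = "syl (shift k e0 xs)"
  have "twist k (syl (p # xs)) \<cdot> apow (k * of_bool e0) =
    img [La] (apow k \<cdot> [Lb]) (bl ?e) \<cdot> apow (snd p) \<cdot> twist k (syl xs) \<cdot> apow (k * of_bool e0)"
    by simp
  also have "\<dots> = apow (k * of_bool ?e) \<cdot> [bl ?e] \<cdot> apow (- k * of_bool (\<not> ?e)) \<cdot> apow (snd p) \<cdot>
      apow (k * of_bool (nxt e0 xs)) \<cdot> ?s"
    unfolding Cons.IH twist_bl by (simp del: foldr_Cons)
  also have "\<dots> = apow (k * of_bool ?e) \<cdot> [bl ?e] \<cdot>
      apow (snd p + k * gap ?e (nxt e0 xs)) \<cdot> ?s"
    by (simp add: gap_def algebra_simps del: foldr_Cons)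
  finally show ?case by simp
qed (simp del: foldr_Cons)

lemma curve_twist_syl:
  assumes "xs \<noteq> []"
  shows "curve_of (twist k (syl xs)) = curve_of (syl (shift k (fst (hd xs)) xs))"
proof -
  let ?e = "fst (hd xs)" let ?a = "apow (k * of_bool ?e)"
  have "nxt ?e xs = ?e" using assms by (cases xs) auto
  then have "twist k (syl xs) \<cdot> ?a = ?a \<cdot> syl (shift k ?e xs)"
    using twist_syl[of k xs ?e] by simp
  then have "(twist k (syl xs) \<cdot> ?a) \<cdot> winv ?a = (?a \<cdot> syl (shift k ?e xs)) \<cdot> winv ?a" by simp
  then have "twist k (syl xs) = ?a \<cdot> syl (shift k ?e xs) \<cdot> winv ?a"
    by (simp del: winv_apow)
  then show ?thesis using curve_of_conj[of "syl (shift k ?e xs)" ?a] by simp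
qed

lemma word_syl: "\<exists>m xs. reduced w \<longrightarrow> w = apow m \<cdot> syl xs"
proof (induction w)
  case Nil
  show ?case by (intro exI[of _ 0] exI[of _ "[]"]) simp
next
  case (Cons l w)
  then obtain m xs where w: "reduced w \<longrightarrow> w = apow m \<cdot> syl xs" by blast
  have "\<exists>m' xs'. [l] \<cdot> apow m \<cdot> syl xs = apow m' \<cdot> syl xs'"
  proof (cases "l \<in> {La, LA}")
    case True
    then have "[l] = apow 1 \<or> [l] = apow (-1)" by (auto simp: apow_def)
    then show ?thesis by (metis apow_add_left reduced_syl)
  next
    case False
    then have "l = bl True \<or> l = bl False" by (cases l) (auto simp: bl_def)
    then obtain e where "l = bl e" by blast
    then have "[l] \<cdot> apow m \<cdot> syl xs = apow 0 \<cdot> syl ((e, m) # xs)" by simp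
    then show ?thesis by blast
  qed
  then obtain m' xs' where m': "[l] \<cdot> apow m \<cdot> syl xs = apow m' \<cdot> syl xs'" by blast
  have "l # w = [l] \<cdot> apow m \<cdot> syl xs" if "reduced (l # w)"
    using that w by (auto simp: lcons_reduced reduced_Cons)
  with m' show ?case by metis
qed

lemma not_adm_split:
  "\<not> adm e0 xs \<Longrightarrow> \<exists>ps e qs. xs = ps @ (e, 0) # qs \<and> nxt e0 qs \<noteq> e"
proof (induction xs)
  case (Cons p xs)
  show ?case
  proof (cases "adm e0 xs")
    case True
    then have "p # xs = [] @ (fst p, 0) # xs \<and> nxt e0 xs \<noteq> fst p"
      using Cons.prems by (cases p) auto
    then show ?thesis by blast
  next
    case False
    then obtain ps e qs where "xs = ps @ (e, 0) # qs \<and> nxt e0 qs \<noteq> e" using Cons.IH by blast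
    then have "p # xs = (p # ps) @ (e, 0) # qs \<and> nxt e0 qs \<noteq> e" by simp
    then show ?thesis by blast
  qed
qed simp

text \<open>A representative with the fewest letters b and B has no cyclically adjacent cancelling
  pair, for removing one would lower their number.\<close>

lemma curve_syl_cases:
  assumes "\<gamma> \<in> curves"
  obtains m where "\<gamma> = curve_of (apow m)"
  | xs where "xs \<noteq> []" "\<gamma> = curve_of (syl xs)" "adm (fst (hd xs)) xs"
proof -
  define Q where "Q xs \<longleftrightarrow> (\<exists>m. \<gamma> = curve_of (apow m \<cdot> syl xs))" for xs
  obtain w where "reduced w" "\<gamma> = curve_of w" using assms by (rule curves_cases)
  then have "\<exists>xs. Q xs" using word_syl[of w] unfolding Q_def by metis
  then obtain xs where xs: "Q xs" "\<And>ys. Q ys \<Longrightarrow> length xs \<le> length ys"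
    using ex_has_least_nat[of Q _ length] by blast
  obtain m where m: "\<gamma> = curve_of (apow m \<cdot> syl xs)" using xs(1) by (auto simp: Q_def)
  show thesis
  proof (cases xs rule: rev_cases)
    case Nil
    then show thesis using m that(1) by simp
  next
    case (snoc ys p)
    \<comment> \<open>The leading power of a is moved cyclically to the end and absorbed by the last
      exponent.\<close>
    define zs where "zs = ys @ [(fst p, snd p + m)]"
    have "syl xs \<cdot> apow m = syl zs"
      by (simp add: snoc zs_def syl_append apow_add del: foldr_Cons)
    then have \<gamma>: "\<gamma> = curve_of (syl zs)"
      using m curve_of_mul_commute[of "apow m" "syl xs"] by simp
    have len: "length zs = length xs" and ne: "zs \<noteq> []" by (auto simp: zs_def snoc)
    have "adm (fst (hd zs)) zs"
    proof (rule ccontr)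
      assume "\<not> adm (fst (hd zs)) zs"
      then obtain ps e qs where split: "zs = ps @ (e, 0) # qs" "nxt (fst (hd zs)) qs \<noteq> e"
        using not_adm_split by blast
      obtain p' ts where ts: "qs @ ps = p' # ts" "fst p' \<noteq> e"
        using split by (cases qs; cases ps) auto
      have "syl zs = syl ps \<cdot> syl ((e, 0) # qs)" by (simp only: split(1) syl_append)
      then have "curve_of (syl zs) = curve_of (syl ((e, 0) # qs) \<cdot> syl ps)"
        using curve_of_mul_commute[of "syl ps" "syl ((e, 0) # qs)"] by (simp add: reduced_lcons)
      also have "syl ((e, 0) # qs) \<cdot> syl ps = syl ((e, 0) # p' # ts)"
        by (simp only: syl_append[symmetric] append_Cons ts(1))
      also have "\<dots> = [bl e] \<cdot> winv [bl e] \<cdot> apow (snd p') \<cdot> syl ts"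
        using ts(2) by (cases e; cases "fst p'") (simp_all add: bl_def)
      also have "\<dots> = apow (snd p') \<cdot> syl ts" by (rule mul_winv_cancel) simp
      finally have "Q ts" using \<gamma> unfolding Q_def by blast
      from xs(2)[OF this] len show False
        using arg_cong[OF split(1), of length] arg_cong[OF ts(1), of length] by simp
    qed
    with ne \<gamma> show thesis by (rule that(2))
  qed
qed

lemma mod_act_twist: "reduced w \<Longrightarrow> mod_act (mat2 1 k 0 1) (curve_of w) = curve_of (twist k w)"
  using mod_act_iso[OF twist_iso(1)] unfolding twist_iso(2) by blast

text \<open>The twist changes the exponents of \<open>a\<close> between two equal letters \<open>b\<close> or \<open>B\<close> of a cyclically
  reduced word and no others. So either it fixes the word or lengths grow under iteration.\<close>

lemma twist_twist_fixed:
  assumes "\<gamma> \<in> curves" "mod_act (mat2 1 2 0 1) \<gamma> = \<gamma>"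
  shows "mod_act matL \<gamma> = \<gamma>"
  using assms(1)
proof (cases rule: curve_syl_cases)
  case (1 m)
  then show ?thesis using mod_act_twist[of "apow m" 1] by (simp add: mats)
next
  case (2 xs)
  let ?e = "fst (hd xs)"
  have shift: "mod_act (mat2 1 k 0 1) \<gamma> = curve_of (syl (shift k ?e xs))" for k
    using mod_act_twist[of "syl xs" k] curve_twist_syl[OF 2(1)] 2(2) by simp
  have fixed: "mod_act (mat2 1 (2 * int j) 0 1) \<gamma> = \<gamma>" for j
  proof (induction j)
    case 0
    show ?case using mod_act_one[OF assms(1)] by (simp add: mats)
  next
    case (Suc j)
    have "mat2 1 (2 * int (Suc j)) 0 1 = mat2 1 (2 * int j) 0 1 ** mat2 1 2 0 1" by simp
    then show ?case using mod_act_mult[of "mat2 1 (2 * int j) 0 1" "mat2 1 2 0 1" \<gamma>] Suc assms by simp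
  qed
  \<comment> \<open>Even twists fix the curve and keep the word cyclically reduced, and cyclically
    reduced words are shortest among the representatives of their curve.\<close>
  have bound: "length (wd (shift (2 * int j) ?e xs)) \<le> length (wd xs)" for j
  proof (rule cyclically_reduced_curve_le)
    let ?ys = "shift (2 * int j) ?e xs"
    have ys: "adm ?e ?ys" "?ys \<noteq> []" "fst (hd ?ys) = ?e"
      using adm_shift[OF 2(3)] 2(1) by (cases xs; simp)+
    show cyc: "cyclically_reduced (wd ?ys)"
      using cyclically_reduced_wd[of ?ys] ys by simp
    have "curve_of (wd ?ys) = curve_of (wd xs)"
      using shift[of "2 * int j"] fixed[of j] 2(2) syl_eq_wd[OF ys(1)] syl_eq_wd[OF 2(3)] by simp
    then show "wd ?ys \<in> curve_of (wd xs)"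
      using curve_of_self[of "wd ?ys"] cyc by (auto simp: cyclically_reduced_def)
    show "reduced (wd xs)"
      using cyclically_reduced_wd[OF 2(3,1)] by (simp add: cyclically_reduced_def)
  qed
  have "\<not> (\<exists>C. \<forall>k. k \<le> length (wd (shift (int k) ?e xs)) + C)"
  proof
    assume "\<exists>C. \<forall>k. k \<le> length (wd (shift (int k) ?e xs)) + C"
    then obtain C where C: "k \<le> length (wd (shift (int k) ?e xs)) + C" for k by blast
    from C[of "2 * (length (wd xs) + C + 1)"] bound[of "length (wd xs) + C + 1"] show False
      by simp
  qed
  then have "shift 1 ?e xs = xs" using shift_fixed_or_grows[of ?e xs] by blast
  then show ?thesis using shift[of 1] 2(2) by (simp add: mats)
qed

section \<open>Stabilizers\<close>

lemma inv_SL2Z: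
  assumes "a * d - b * c = 1"
  shows "inv\<^bsub>SL2Z\<^esub> (mat2 a b c d) = mat2 d (- b) (- c) a"
  by (rule group.inv_equality[OF group_SL2Z]) (use assms in \<open>auto simp: mats algebra_simps\<close>)

lemma generate_commutes:
  assumes "\<And>g. g \<in> G \<Longrightarrow> det g = 1 \<and> g ** X = X ** g" "h \<in> generate SL2Z G"
  shows "h ** X = X ** h"
  using assms(2)
proof induction
  case (inv h)
  obtain a b c d where h: "h = mat2 a b c d" by (rule mat2_cases)
  obtain p q r s where X: "X = mat2 p q r s" by (rule mat2_cases)
  have comm: "h ** X = X ** h" and det: "a * d - b * c = 1" using assms(1)[OF inv] by (auto simp: h)
  have "mat2 d (- b) (- c) a ** X = X ** mat2 d (- b) (- c) a"
    using comm unfolding h X mat2_mult mat2_eq_iff by algebra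
  then show ?case unfolding h inv_SL2Z[OF det] .
next
  case (eng h1 h2)
  have "(h1 ** h2) ** X = h1 ** (h2 ** X)" by (rule matrix_mul_assoc[symmetric])
  also have "\<dots> = (h1 ** X) ** h2" unfolding eng.IH(2) by (rule matrix_mul_assoc)
  also have "\<dots> = X ** (h1 ** h2)" unfolding eng.IH(1) by (rule matrix_mul_assoc[symmetric])
  finally show ?case by simp
qed (use assms(1) in auto)

lemma generate_L:
  assumes "h \<in> generate SL2Z {matL}"
  shows "\<exists>t. h = mat2 1 t 0 1"
  using assms
proof induction
  case (eng h1 h2)
  then show ?case by fastforce
qed (auto simp: mats inv_SL2Z)

lemma mod_stab_iff: "M \<in> mod_stab \<gamma> \<longleftrightarrow> det M = 1 \<and> mod_act M \<gamma> = \<gamma>"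
  by (simp add: mod_stab_def)

lemma mod_stab_mult:
  "\<gamma> \<in> curves \<Longrightarrow> M \<in> mod_stab \<gamma> \<Longrightarrow> N \<in> mod_stab \<gamma> \<Longrightarrow> M ** N \<in> mod_stab \<gamma>"
  by (auto simp: mod_stab_iff det_mul mod_act_mult)

lemma mod_stab_adjugate:
  assumes "\<gamma> \<in> curves" "mat2 a b c d \<in> mod_stab \<gamma>"
  shows "mat2 d (- b) (- c) a \<in> mod_stab \<gamma>"
proof -
  have det: "det (mat2 a b c d) = 1" "det (mat2 d (- b) (- c) a) = 1"
    and fixed: "mod_act (mat2 a b c d) \<gamma> = \<gamma>"
    using assms(2) by (auto simp: mod_stab_iff algebra_simps)
  have "mat2 d (- b) (- c) a ** mat2 a b c d = mat 1"
    using det by (auto simp: mats algebra_simps)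
  then have "mod_act (mat2 d (- b) (- c) a) (mod_act (mat2 a b c d) \<gamma>) = \<gamma>"
    using mod_act_mult[OF det(2,1) assms(1)] mod_act_one[OF assms(1)] by simp
  with det fixed show ?thesis by (simp add: mod_stab_iff)
qed

lemma mod_stab_twist:
  assumes "\<gamma> \<in> curves" "matL \<in> mod_stab \<gamma>"
  shows "mat2 1 t 0 1 \<in> mod_stab \<gamma>"
proof -
  have L: "mat2 1 1 0 1 \<in> mod_stab \<gamma>" using assms by (simp add: mats)
  have nonneg: "mat2 1 (int k) 0 1 \<in> mod_stab \<gamma>" for k
  proof (induction k)
    case 0
    show ?case using mod_act_one[OF assms(1)] by (simp add: mod_stab_iff mats)
  next
    case (Suc k)
    from mod_stab_mult[OF assms(1) L this] show ?case by (simp add: add.commute)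
  qed
  obtain k where "t = int k \<or> t = - int k" by (metis int_cases2)
  then show ?thesis
    using nonneg[of k] mod_stab_adjugate[OF assms(1) nonneg[of k]] by auto
qed

lemma mod_act_eq_stab:
  assumes "\<gamma> \<in> curves" "det M = 1" "det M' = 1" "mod_act M \<gamma> = mod_act M' \<gamma>"
  obtains h where "h \<in> mod_stab \<gamma>" "M' = M ** h"
proof -
  obtain a b c d where M: "M = mat2 a b c d" by (rule mat2_cases)
  let ?N = "mat2 d (- b) (- c) a"
  have NM: "?N ** M = mat 1" "M ** ?N = mat 1" and N: "det ?N = 1"
    using assms(2) by (auto simp: M mats algebra_simps)
  have "mod_act (?N ** M') \<gamma> = mod_act (?N ** M) \<gamma>"
    using assms N by (simp add: mod_act_mult)
  then have "?N ** M' \<in> mod_stab \<gamma>"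
    using NM mod_act_one assms N by (simp add: mod_stab_iff det_mul)
  moreover have "M' = M ** (?N ** M')"
    using NM(2) by (simp add: matrix_mul_assoc)
  ultimately show thesis by (rule that)
qed

section \<open>Quadrant conditions against the centralizers of S, U and L\<close>

lemma quad_left_zero:
  assumes "quad (mat2 a b c d)"
  shows "c = 0 \<Longrightarrow> a = 1 \<and> d = 1 \<and> 0 \<le> b" "a = 0 \<Longrightarrow> c = 1 \<and> b = -1 \<and> d \<le> 0"
proof -
  assume "c = 0"
  then have "a * d = 1" "0 \<le> a" using assms by (auto simp: quad_mat2)
  then have "a = 1" "d = 1" by (auto simp: zmult_eq_1_iff)
  then show "a = 1 \<and> d = 1 \<and> 0 \<le> b" using assms by (auto simp: quad_mat2)
next
  assume "a = 0"
  then have "b * c = -1" "0 \<le> c" using assms by (auto simp: quad_mat2)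
  then have "c = 1" "b = -1" by (auto simp: zmult_eq_neg1_iff)
  then show "c = 1 \<and> b = -1 \<and> d \<le> 0" using assms by (auto simp: quad_mat2)
qed

lemma quad_right_opposite:
  assumes "quad (mat2 a b c d)"
  shows "\<not> (0 \<le> b \<and> d \<le> 0)"
    "b \<le> 0 \<Longrightarrow> 0 \<le> d \<Longrightarrow> b = 0 \<and> a = 1 \<and> d = 1 \<or> d = 0 \<and> b = -1 \<and> c = 1"
proof -
  have det: "a * d - b * c = 1" and pos: "0 \<le> a" "0 \<le> c"
    using assms by (auto simp: quad_mat2)
  show "\<not> (0 \<le> b \<and> d \<le> 0)"
  proof
    assume "0 \<le> b \<and> d \<le> 0"
    then have "a * d \<le> 0" "0 \<le> b * c" using pos by (simp_all add: mult_nonneg_nonpos)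
    then show False using det by linarith
  qed
  assume bd: "b \<le> 0" "0 \<le> d"
  then consider "b = 0" | "d = 0" using assms by (auto simp: quad_mat2)
  then show "b = 0 \<and> a = 1 \<and> d = 1 \<or> d = 0 \<and> b = -1 \<and> c = 1"
  proof cases
    case 1
    then have "a * d = 1" using det by simp
    then show ?thesis using 1 pos by (auto simp: zmult_eq_1_iff)
  next
    case 2
    then have "b * c = -1" using det by simp
    then show ?thesis using 2 pos by (auto simp: zmult_eq_neg1_iff)
  qed
qed

text \<open>The norm of the Gaussian integers, which is the determinant on the centralizer of
  \<open>matS\<close>.\<close>

lemma unit_norm_S:
  assumes "x\<^sup>2 + z\<^sup>2 = (1::int)"
  shows "(x, z) \<in> {(1, 0), (-1, 0), (0, 1), (0, -1)}"
proof -
  have "x\<^sup>2 \<le> 1" "z\<^sup>2 \<le> 1" using assms zero_le_power2[of x] zero_le_power2[of z] by linarith+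
  then have "x \<in> {-1, 0, 1}" "z \<in> {-1, 0, 1}" by (auto simp: abs_square_le_1)
  then show ?thesis using assms by auto
qed

text \<open>The norm of the Eisenstein integers, which is the determinant on the centralizer of
  \<open>matU\<close>. Multiplying by 4 and completing the square in either variable bounds the
  other.\<close>

lemma unit_norm_U:
  assumes "x\<^sup>2 - x * z + z\<^sup>2 = (1::int)"
  shows "(x, z) \<in> {(1, 0), (-1, 0), (0, 1), (0, -1), (1, 1), (-1, -1)}"
proof -
  have "(2 * x - z)\<^sup>2 + 3 * z\<^sup>2 = 4" "(2 * z - x)\<^sup>2 + 3 * x\<^sup>2 = 4"
    using assms by (simp_all add: power2_eq_square algebra_simps)
  then have "x\<^sup>2 \<le> 1" "z\<^sup>2 \<le> 1"
    using zero_le_power2[of "2 * x - z"] zero_le_power2[of "2 * z - x"] by linarith+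
  then have "x \<in> {-1, 0, 1}" "z \<in> {-1, 0, 1}" by (auto simp: abs_square_le_1)
  then show ?thesis using assms by auto
qed

text \<open>Consequences of determinant 1 without products of entries, so that the case analyses
  below become linear arithmetic.\<close>

lemma quad_linear:
  assumes "quad (mat2 a b c d)"
  shows "0 \<le> a \<and> 0 \<le> c \<and> (0 \<le> b \<and> 0 \<le> d \<or> b \<le> 0 \<and> d \<le> 0)
    \<and> (c = 0 \<longrightarrow> a = 1 \<and> d = 1) \<and> (a = 0 \<longrightarrow> c = 1 \<and> b = -1) \<and> \<not> (0 \<le> b \<and> d \<le> 0)
    \<and> (b \<le> 0 \<and> 0 \<le> d \<longrightarrow> b = 0 \<and> a = 1 \<and> d = 1 \<or> d = 0 \<and> b = -1 \<and> c = 1)"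
  using quad_left_zero[OF assms] quad_right_opposite[OF assms] assms unfolding quad_mat2 by blast

text \<open>\<open>h\<close> is one of the four Gaussian units, so \<open>matS ** M ** h\<close>
  only permutes the entries of \<open>M\<close> up to sign, and the two sign patterns clash except
  at the roots.\<close>

lemma quad_rotate_S:
  assumes "quad M" "quad (matS ** M ** h)" "det h = 1" "h ** matS = matS ** h"
  shows "{M, matS ** M ** h} \<inter> {mat 1, matS} \<noteq> {}"
proof -
  obtain a b c d where M: "M = mat2 a b c d" by (rule mat2_cases)
  obtain x y z w where h: "h = mat2 x y z w" by (rule mat2_cases)
  have yw: "y = - z" "w = x" using assms(4) unfolding h mats(5) mat2_mult mat2_eq_iff by linarith+
  then have "x\<^sup>2 + z\<^sup>2 = 1" using assms(3) by (simp add: h power2_eq_square)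
  from unit_norm_S[OF this]
  consider "x = 1" "z = 0" | "x = -1" "z = 0" | "x = 0" "z = 1" | "x = 0" "z = -1" by auto
  then have "M = mat2 1 0 0 1 \<or> M = mat2 0 (-1) 1 0"
  proof cases
    case 1
    then have "quad (mat2 (- c) (- d) a b)" using assms(2) by (simp add: M h yw mats)
    from quad_linear[OF this] quad_linear[OF assms(1)[unfolded M]] show ?thesis unfolding M mat2_eq_iff by smt
  next
    case 2
    then have "quad (mat2 c d (- a) (- b))" using assms(2) by (simp add: M h yw mats)
    from quad_linear[OF this] quad_linear[OF assms(1)[unfolded M]] show ?thesis unfolding M mat2_eq_iff by smt
  next
    case 3
    then have "quad (mat2 (- d) c b (- a))" using assms(2) by (simp add: M h yw mats)
    from quad_linear[OF this] quad_linear[OF assms(1)[unfolded M]] show ?thesis unfolding M mat2_eq_iff by smt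
  next
    case 4
    then have "quad (mat2 d (- c) (- b) a)" using assms(2) by (simp add: M h yw mats)
    from quad_linear[OF this] quad_linear[OF assms(1)[unfolded M]] show ?thesis unfolding M mat2_eq_iff by smt
  qed
  then show ?thesis by (auto simp: mats)
qed

text \<open>There are six Eisenstein units. Unlike for \<open>matS\<close>, the root may be the
  turned matrix rather than \<open>M\<close>, which explains the symmetric conclusion.\<close>

lemma quad_rotate_U:
  assumes "quad M" "quad (matS ** M ** h)" "det h = 1" "h ** matU = matU ** h"
  shows "{M, matS ** M ** h} \<inter> {mat 1, matS} \<noteq> {}"
proof -
  obtain a b c d where M: "M = mat2 a b c d" by (rule mat2_cases)
  obtain x y z w where h: "h = mat2 x y z w" by (rule mat2_cases)
  have yw: "y = - z" "w = x - z" using assms(4) unfolding h mats(6) mat2_mult mat2_eq_iff by linarith+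
  then have "x\<^sup>2 - x * z + z\<^sup>2 = 1"
    using assms(3) unfolding h det_mat2 yw by (simp add: power2_eq_square algebra_simps)
  from unit_norm_U[OF this]
  consider "x = 1" "z = 0" | "x = -1" "z = 0" | "x = 0" "z = 1" | "x = 0" "z = -1"
    | "x = 1" "z = 1" | "x = -1" "z = -1" by auto
  then have "M = mat2 1 0 0 1 \<or> M = mat2 0 (-1) 1 0
    \<or> matS ** M ** h = mat2 1 0 0 1 \<or> matS ** M ** h = mat2 0 (-1) 1 0"
  proof cases
    case 1
    then have M': "matS ** M ** h = mat2 (- c) (- d) a b" by (simp add: M h yw mats)
    from quad_linear[OF assms(2)[unfolded M']] quad_linear[OF assms(1)[unfolded M]] show ?thesis
      unfolding M' unfolding M mat2_eq_iff by smt
  next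
    case 2
    then have M': "matS ** M ** h = mat2 c d (- a) (- b)" by (simp add: M h yw mats)
    from quad_linear[OF assms(2)[unfolded M']] quad_linear[OF assms(1)[unfolded M]] show ?thesis
      unfolding M' unfolding M mat2_eq_iff by smt
  next
    case 3
    then have M': "matS ** M ** h = mat2 (- d) (c + d) b (- a - b)" by (simp add: M h yw mats)
    from quad_linear[OF assms(2)[unfolded M']] quad_linear[OF assms(1)[unfolded M]] show ?thesis
      unfolding M' unfolding M mat2_eq_iff by smt
  next
    case 4
    then have M': "matS ** M ** h = mat2 d (- c - d) (- b) (a + b)" by (simp add: M h yw mats)
    from quad_linear[OF assms(2)[unfolded M']] quad_linear[OF assms(1)[unfolded M]] show ?thesis
      unfolding M' unfolding M mat2_eq_iff by smt
  next
    case 5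
    then have M': "matS ** M ** h = mat2 (- c - d) c (a + b) (- a)" by (simp add: M h yw mats)
    from quad_linear[OF assms(2)[unfolded M']] quad_linear[OF assms(1)[unfolded M]] show ?thesis
      unfolding M' unfolding M mat2_eq_iff by smt
  next
    case 6
    then have M': "matS ** M ** h = mat2 (c + d) (- c) (- a - b) a" by (simp add: M h yw mats)
    from quad_linear[OF assms(2)[unfolded M']] quad_linear[OF assms(1)[unfolded M]] show ?thesis
      unfolding M' unfolding M mat2_eq_iff by smt
  qed
  then show ?thesis by (auto simp: mats)
qed

text \<open>Up to sign \<open>h\<close> fixes the first basis vector, so the first column of
  \<open>M\<close> and its quarter turn both lie on the boundary of a quadrant. The infinitely many
  exceptions all give \<gamma> or S(\<gamma>) once \<open>matL\<close> is in the stabilizer.\<close>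

lemma quad_rotate_L:
  assumes "quad M" "quad (matS ** M ** h)" "det h = 1" "h ** matL = matL ** h"
  shows "\<exists>t. M = mat2 1 t 0 1 \<or> M = matS ** mat2 1 t 0 1"
proof -
  obtain a b c d where M: "M = mat2 a b c d" by (rule mat2_cases)
  obtain x y z w where h: "h = mat2 x y z w" by (rule mat2_cases)
  have zw: "z = 0" "w = x" using assms(4) unfolding h mats(3) mat2_mult mat2_eq_iff by linarith+
  then have "x = 1 \<or> x = -1" using assms(3) by (auto simp: h zmult_eq_1_iff)
  then have "a = 0 \<or> c = 0"
    using assms(1,2) by (auto simp: M h zw mats quad_mat2)
  then show ?thesis
    using quad_left_zero[of a b c d] assms(1) by (auto simp: M mats)
qed

text \<open>Both curves have the same length by invariance under \<open>matS\<close>, so it is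
  enough that one of the two matrices leads to \<gamma> or S(\<gamma>).\<close>

lemma quad_quarter_turn:
  assumes \<gamma>: "\<gamma> \<in> curves"
    and H: "(\<forall>h\<in>mod_stab \<gamma>. h ** matS = matS ** h) \<or> (\<forall>h\<in>mod_stab \<gamma>. h ** matU = matU ** h)
      \<or> matL \<in> mod_stab \<gamma> \<and> (\<forall>h\<in>mod_stab \<gamma>. h ** matL = matL ** h)"
    and M: "quad M" "quad M'" "mod_act (matS ** M) \<gamma> = mod_act M' \<gamma>"
  shows "curve_length (mod_act M \<gamma>) = curve_length \<gamma>"
proof -
  have det: "det matS = 1" "det M = 1" "det M' = 1" using M by (auto simp: mats quad_def)
  have S: "curve_length (mod_act (matS ** N) \<gamma>) = curve_length (mod_act N \<gamma>)" if "det N = 1" for N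
    using that det \<gamma> by (simp add: mod_act_mult curve_length_S mod_act_closed)
  have root: "curve_length (mod_act N \<gamma>) = curve_length \<gamma>" if "N \<in> {mat 1, matS}" for N
    using that \<gamma> curve_length_S mod_act_one by auto
  have same: "curve_length (mod_act M \<gamma>) = curve_length (mod_act M' \<gamma>)"
    using S[OF det(2)] M(3) by simp
  obtain h where h: "h \<in> mod_stab \<gamma>" "M' = matS ** M ** h"
    using mod_act_eq_stab[OF \<gamma> _ det(3) M(3)] det by (auto simp: det_mul)
  then have deth: "det h = 1" by (simp add: mod_stab_iff)
  have special: "curve_length (mod_act M \<gamma>) = curve_length \<gamma>" if "{M, M'} \<inter> {mat 1, matS} \<noteq> {}"
    using that root[of M] root[of M'] same by auto
  from H show ?thesis
  proof (elim disjE conjE)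
    assume "\<forall>h\<in>mod_stab \<gamma>. h ** matS = matS ** h"
    then show ?thesis using special quad_rotate_S[of M h] M h deth by auto
  next
    assume "\<forall>h\<in>mod_stab \<gamma>. h ** matU = matU ** h"
    then show ?thesis using special quad_rotate_U[of M h] M h deth by auto
  next
    assume L: "matL \<in> mod_stab \<gamma>" and comm: "\<forall>h\<in>mod_stab \<gamma>. h ** matL = matL ** h"
    have "\<exists>t. M = mat2 1 t 0 1 \<or> M = matS ** mat2 1 t 0 1"
      using quad_rotate_L[of M h] M h deth comm by auto
    moreover have "mod_act (mat2 1 t 0 1) \<gamma> = \<gamma>" for t
      using mod_stab_twist[OF \<gamma> L] by (simp add: mod_stab_iff)
    ultimately show ?thesis using S[of "mat2 1 _ 0 1"] by auto
  qed
qed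

text \<open>If \<open>M\<close> has columns u, v, the two candidates have columns -v, u + v and u +
  v, -u. One of them fits unless v is nonpositive and u + v has entries of strictly opposite signs,
  which determinant 1 permits only for \<open>matS\<close>.\<close>

lemma quad_half_turn_U:
  assumes "quad M"
  shows "M \<in> {mat 1, matS} \<or> quad (- (M ** matU)) \<or> quad (- (M ** matU ** matU))"
proof -
  obtain a b c d where M: "M = mat2 a b c d" by (rule mat2_cases)
  have det: "a * d - b * c = 1" and pos: "0 \<le> a" "0 \<le> c"
    and alt: "0 \<le> b \<and> 0 \<le> d \<or> b \<le> 0 \<and> d \<le> 0"
    using assms by (auto simp: M quad_mat2)
  have U: "- (M ** matU) = mat2 (- b) (a + b) (- d) (c + d)"
    "- (M ** matU ** matU) = mat2 (a + b) (- a) (c + d) (- c)"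
    by (auto simp: M mats)
  consider "0 \<le> b" "0 \<le> d" | "b \<le> 0" "d \<le> 0" "0 \<le> a + b" "0 \<le> c + d"
    | "b \<le> 0" "d \<le> 0" "a + b \<le> 0" "c + d \<le> 0"
    | "b \<le> 0" "d \<le> 0" "0 < a + b" "c + d < 0" | "b \<le> 0" "d \<le> 0" "a + b < 0" "0 < c + d"
    using alt by linarith
  then show ?thesis
  proof cases
    case 4
    have "c * (- b) \<le> (- d - 1) * (- b)" "(1 - b) * (- d) \<le> a * (- d)"
      using 4 by (intro mult_right_mono; simp)+
    then show ?thesis using det 4 by (simp add: algebra_simps)
  next
    case 5
    have "(1 - d) * (- b) \<le> c * (- b)" "a * (- d) \<le> (- b - 1) * (- d)"
      using 5 by (intro mult_right_mono; simp)+
    then have "- b - d \<le> 1" using det by (simp add: algebra_simps)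
    then have "b = -1" "d = 0" "a = 0" using 5 pos by auto
    then show ?thesis using det by (simp add: M mats)
  qed (use pos det in \<open>auto simp: U quad_mat2 algebra_simps\<close>)
qed

text \<open>An infinite set has \<open>card\<close> 0, so the equation holds there too and the
  finiteness of the set of curves of a given length need not be established.\<close>

lemma card_union_image:
  assumes "A = B \<union> f ` B" "B \<inter> f ` B = {}" "inj_on f B"
  shows "card A = 2 * card B"
proof (cases "finite B")
  case True
  then show ?thesis using assms by (simp add: card_Un_disjoint card_image)
next
  case False
  then show ?thesis using assms(1) by simp
qed

text \<open>The first disjunction feeds the quarter turn, the second the half turn. The generators S
  and -U reach -I through S^2 = -I and (-U)^3 = -I, and -L through (-L) L^-1 = -I once L is known to
  fix the curve.\<close>

lemma standard_position_stab:
  assumes \<gamma>: "\<gamma> \<in> curves" and std: "standard_position \<gamma>"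
  shows "(\<forall>h\<in>mod_stab \<gamma>. h ** matS = matS ** h) \<or> (\<forall>h\<in>mod_stab \<gamma>. h ** matU = matU ** h)
      \<or> matL \<in> mod_stab \<gamma> \<and> (\<forall>h\<in>mod_stab \<gamma>. h ** matL = matL ** h)" (is ?comm)
    and "- matI \<in> mod_stab \<gamma> \<or> matU \<in> mod_stab \<gamma> \<or> (\<forall>h\<in>mod_stab \<gamma>. \<exists>t. h = mat2 1 t 0 1)" (is ?tors)
proof -
  let ?H = "mod_stab \<gamma>"
  note mult = mod_stab_mult[OF \<gamma>]
  consider "?H = {matI}" | "?H = generate SL2Z {- matI}" | "?H = generate SL2Z {matU}"
    | "?H = generate SL2Z {matS}" | "?H = generate SL2Z {- matU}" | "?H = generate SL2Z {matL}"
    | "?H = generate SL2Z {- matL}" | "?H = generate SL2Z {- matI, matL}"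
    using std unfolding standard_position_def by blast
  then have "?comm \<and> ?tors"
  proof cases
    case 1
    then show ?thesis by (auto simp: mats)
  next
    case 2
    have "\<forall>h\<in>?H. h ** matS = matS ** h"
      unfolding 2 by (intro ballI generate_commutes[of "{- matI}"]) (auto simp: mats)
    moreover have "- matI \<in> ?H" unfolding 2 by (rule generate.incl) simp
    ultimately show ?thesis by blast
  next
    case 3
    have "\<forall>h\<in>?H. h ** matU = matU ** h"
      unfolding 3 by (intro ballI generate_commutes[of "{matU}"]) (auto simp: mats)
    moreover have "matU \<in> ?H" unfolding 3 by (rule generate.incl) simp
    ultimately show ?thesis by blast
  next
    case 4
    have "\<forall>h\<in>?H. h ** matS = matS ** h"
      unfolding 4 by (intro ballI generate_commutes[of "{matS}"]) (auto simp: mats)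
    moreover have "matS \<in> ?H" unfolding 4 by (rule generate.incl) simp
    from mult[OF this this] have "- matI \<in> ?H" by (simp add: mats)
    ultimately show ?thesis by blast
  next
    case 5
    have "\<forall>h\<in>?H. h ** matU = matU ** h"
      unfolding 5 by (intro ballI generate_commutes[of "{- matU}"]) (auto simp: mats)
    moreover have "- matU \<in> ?H" unfolding 5 by (rule generate.incl) simp
    from mult[OF this mult[OF this this]] have "- matI \<in> ?H" by (simp add: mats)
    ultimately show ?thesis by blast
  next
    case 6
    have "\<forall>h\<in>?H. h ** matL = matL ** h"
      unfolding 6 by (intro ballI generate_commutes[of "{matL}"]) (auto simp: mats)
    moreover have "matL \<in> ?H" unfolding 6 by (rule generate.incl) simp
    moreover have "\<forall>h\<in>?H. \<exists>t. h = mat2 1 t 0 1"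
      unfolding 6 using generate_L by blast
    ultimately show ?thesis by blast
  next
    case 7
    have "\<forall>h\<in>?H. h ** matL = matL ** h"
      unfolding 7 by (intro ballI generate_commutes[of "{- matL}"]) (auto simp: mats)
    moreover have nL: "- matL \<in> ?H" unfolding 7 by (rule generate.incl) simp
    from mult[OF this this] have "mat2 1 2 0 1 \<in> ?H" by (simp add: mats)
    then have "mod_act matL \<gamma> = \<gamma>"
      using twist_twist_fixed[OF \<gamma>] by (simp add: mod_stab_iff)
    then have L: "matL \<in> ?H" by (simp add: mod_stab_iff mats)
    moreover have "- matI \<in> ?H"
      using mult[OF nL mod_stab_twist[OF \<gamma> L, of "-1"]] by (simp add: mats)
    ultimately show ?thesis by blast
  next
    case 8
    have "\<forall>h\<in>?H. h ** matL = matL ** h"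
      unfolding 8 by (intro ballI generate_commutes[of "{- matI, matL}"]) (auto simp: mats)
    moreover have "matL \<in> ?H" "- matI \<in> ?H" unfolding 8 by (auto intro: generate.incl)
    ultimately show ?thesis by blast
  qed
  then show ?comm ?tors by auto
qed

section \<open>Torsion in the stabilizer and the final count\<close>

lemma torsion_if:
  assumes "- matI \<in> H \<or> matU \<in> H"
  shows "has_nontrivial_torsion H"
proof -
  have "(- matI) [^]\<^bsub>SL2Z\<^esub> (2::nat) = \<one>\<^bsub>SL2Z\<^esub>" "matU [^]\<^bsub>SL2Z\<^esub> (3::nat) = \<one>\<^bsub>SL2Z\<^esub>"
    by (simp_all add: mats nat_pow_def numeral_2_eq_2 numeral_3_eq_3)
  moreover have "- matI \<noteq> \<one>\<^bsub>SL2Z\<^esub>" "matU \<noteq> \<one>\<^bsub>SL2Z\<^esub>"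
    by (simp_all add: mats)
  moreover have "(2::nat) > 0" "(3::nat) > 0" by auto
  ultimately show ?thesis
    using assms unfolding has_nontrivial_torsion_def by blast
qed

lemma no_torsion_if:
  assumes "\<And>h. h \<in> H \<Longrightarrow> \<exists>t. h = mat2 1 t 0 1"
  shows "\<not> has_nontrivial_torsion H"
proof -
  have pow: "mat2 1 t 0 1 [^]\<^bsub>SL2Z\<^esub> k = mat2 1 (int k * t) 0 1" for t and k :: nat
    by (induction k) (simp_all add: mats nat_pow_def algebra_simps)
  have False if "M \<in> H" "M \<noteq> mat 1" "k > 0" "M [^]\<^bsub>SL2Z\<^esub> k = mat 1" for M and k :: nat
    using assms[OF that(1)] that(2-4) by (auto simp: pow) (auto simp: mats)
  then show ?thesis by (auto simp: has_nontrivial_torsion_def)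
qed

theorem proposition1p4:
  fixes \<gamma> :: curve
  assumes "essential \<gamma>"
  shows "(\<forall>\<alpha>\<in>mod_orbit \<gamma>. \<exists>k\<in>{0, 1, 2, 3::nat}.
            mod_act (matS [^]\<^bsub>SL2Z\<^esub> k) \<alpha> \<in> tree \<gamma> \<union> tree (mod_act matS \<gamma>))
       \<and> (standard_position \<gamma> \<and> (\<forall>\<alpha>\<in>mod_orbit \<gamma>. curve_length \<gamma> \<le> curve_length \<alpha>) \<longrightarrow>
            (\<forall>n > curve_length \<gamma>.
               card {\<alpha> \<in> mod_orbit \<gamma>. curve_length \<alpha> = n} =
               (if has_nontrivial_torsion (mod_stab \<gamma>) then 2 else 4) *
               card {\<alpha> \<in> tree \<gamma> \<union> tree (mod_act matS \<gamma>). curve_length \<alpha> = n}))"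
    (is "?rotate \<and> (_ \<longrightarrow> ?count)")
proof -
  have \<gamma>: "\<gamma> \<in> curves" using assms by (simp add: essential_def)
  let ?T = "tree \<gamma> \<union> tree (mod_act matS \<gamma>)"
  have T: "?T = (\<lambda>M. mod_act M \<gamma>) ` {M. quad M}" by (rule tree_Un[OF \<gamma>])
  have det_S: "det (matS [^]\<^bsub>SL2Z\<^esub> k) = 1" for k :: nat
    using group.is_monoid[OF group_SL2Z] monoid.nat_pow_closed[of SL2Z matS k] by (simp add: mats)
  have rotate: ?rotate
  proof
    fix \<alpha> assume "\<alpha> \<in> mod_orbit \<gamma>"
    then obtain M where M: "det M = 1" "\<alpha> = mod_act M \<gamma>" by (auto simp: mod_orbit_def)
    obtain k :: nat where "k \<in> {0, 1, 2, 3}" "quad (matS [^]\<^bsub>SL2Z\<^esub> k ** M)"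
      using SL2Z_rotate_quad[OF M(1)] by blast
    moreover have "mod_act (matS [^]\<^bsub>SL2Z\<^esub> k) \<alpha> = mod_act (matS [^]\<^bsub>SL2Z\<^esub> k ** M) \<gamma>"
      using mod_act_mult[OF det_S M(1) \<gamma>] M(2) by simp
    ultimately show "\<exists>k\<in>{0, 1, 2, 3::nat}. mod_act (matS [^]\<^bsub>SL2Z\<^esub> k) \<alpha> \<in> ?T"
      unfolding T by blast
  qed
  have ?count if std: "standard_position \<gamma>"
  proof (intro allI impI)
    fix n assume n: "curve_length \<gamma> < n"
    let ?H = "mod_stab \<gamma>" and ?s = "mod_act matS" and ?m = "mod_act (- matI)"
    define A where "A = {\<alpha> \<in> mod_orbit \<gamma>. curve_length \<alpha> = n}"
    define B where "B = {\<alpha> \<in> ?T. curve_length \<alpha> = n}"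
    \<comment> \<open>The closure of \<open>B\<close> under the half turn. The quarter turn
      contributes a factor 2 over \<open>C\<close>; the half turn contributes 1 or 2, depending on
      whether it maps \<open>B\<close> to itself or off itself.\<close>
    define C where "C = B \<union> ?m ` B"
    note stab = standard_position_stab[OF \<gamma> std]
    have det: "det matS = 1" "det (- matI) = 1" by (auto simp: mats)
    have B_A: "B \<subseteq> A"
      unfolding A_def B_def T by (auto simp: mod_orbit_def quad_def)
    have A_curves: "\<alpha> \<in> curves" if elem: "\<alpha> \<in> A" for \<alpha>
      using elem mod_act_closed \<gamma> by (auto simp: A_def mod_orbit_def)
    have s_A: "?s \<alpha> \<in> A" if elem: "\<alpha> \<in> A" for \<alpha>
    proof -
      obtain M where M: "det M = 1" "\<alpha> = mod_act M \<gamma>" "curve_length \<alpha> = n"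
        using elem by (auto simp: A_def mod_orbit_def)
      then have "?s \<alpha> = mod_act (matS ** M) \<gamma>" using mod_act_mult[OF det(1) M(1) \<gamma>] by simp
      then show ?thesis
        using M det curve_length_S[OF A_curves[OF elem]] by (auto simp: A_def mod_orbit_def det_mul)
    qed
    have ss: "?s (?s \<alpha>) = ?m \<alpha>" if elem: "\<alpha> \<in> A" for \<alpha>
      using mod_act_mult[OF det(1,1) A_curves[OF elem]] by (simp add: mats)
    have mm: "?m (?m \<alpha>) = \<alpha>" if elem: "\<alpha> \<in> A" for \<alpha>
      using mod_act_mult[OF det(2,2) A_curves[OF elem]] mod_act_one[OF A_curves[OF elem]]
      by (simp add: mats)
    have m_A: "?m \<alpha> \<in> A" if elem: "\<alpha> \<in> A" for \<alpha>
      using s_A[OF s_A[OF elem]] ss[OF elem] by simp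
    have sm: "?s (?m \<alpha>) = ?m (?s \<alpha>)" if elem: "\<alpha> \<in> A" for \<alpha>
      using mod_act_mult[OF det(1,2) A_curves[OF elem]] mod_act_mult[OF det(2,1) A_curves[OF elem]]
      by (simp add: mats)
    have quarter: "?s \<alpha> \<notin> B" if elem: "\<alpha> \<in> B" for \<alpha>
    proof
      assume "?s \<alpha> \<in> B"
      then obtain M M' where M: "quad M" "\<alpha> = mod_act M \<gamma>" "quad M'" "?s \<alpha> = mod_act M' \<gamma>"
        using elem unfolding B_def T by blast
      then have "mod_act (matS ** M) \<gamma> = mod_act M' \<gamma>"
        using mod_act_mult[OF det(1) _ \<gamma>, of M] by (simp add: quad_def)
      from quad_quarter_turn[OF \<gamma> stab(1) M(1,3) this] show False
        using M(2) elem n by (simp add: B_def)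
    qed
    have C_iff: "\<alpha> \<in> C \<longleftrightarrow> \<alpha> \<in> A \<and> (\<alpha> \<in> B \<or> ?m \<alpha> \<in> B)" for \<alpha>
      using B_A mm m_A unfolding C_def by (auto intro: rev_image_eqI)
    have "A = C \<union> ?s ` C"
    proof
      show "A \<subseteq> C \<union> ?s ` C"
      proof
        fix \<alpha> assume \<alpha>: "\<alpha> \<in> A"
        then obtain k :: nat where k: "k \<in> {0, 1, 2, 3}" "mod_act (matS [^]\<^bsub>SL2Z\<^esub> k) \<alpha> \<in> ?T"
          using rotate unfolding A_def by blast
        have inB: "\<beta> \<in> B" if "\<beta> \<in> A" "\<beta> \<in> ?T" for \<beta>
          using that by (simp add: A_def B_def)
        have pow: "mod_act (matS [^]\<^bsub>SL2Z\<^esub> (0::nat)) \<alpha> = \<alpha>"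
          "mod_act (matS [^]\<^bsub>SL2Z\<^esub> (1::nat)) \<alpha> = ?s \<alpha>"
          "mod_act (matS [^]\<^bsub>SL2Z\<^esub> (2::nat)) \<alpha> = ?m \<alpha>"
          "mod_act (matS [^]\<^bsub>SL2Z\<^esub> (3::nat)) \<alpha> = ?m (?s \<alpha>)"
          unfolding matS_pow using mod_act_one[OF A_curves[OF \<alpha>]] mod_act_mult[OF det(2,1) A_curves[OF \<alpha>]]
          by (simp_all add: mats)
        from k(1) consider "k = 0" | "k = 1" | "k = 2" | "k = 3" by auto
        then have "\<alpha> \<in> C \<or> ?s \<alpha> \<in> C"
          using k(2) pow inB[OF \<alpha>] inB[OF s_A[OF \<alpha>]] inB[OF m_A[OF \<alpha>]] inB[OF m_A[OF s_A[OF \<alpha>]]] \<alpha> s_A[OF \<alpha>]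
          unfolding C_iff by cases auto
        then show "\<alpha> \<in> C \<union> ?s ` C"
        proof
          assume C: "?s \<alpha> \<in> C"
          then have "?m (?s \<alpha>) \<in> C"
            using mm[OF s_A[OF \<alpha>]] m_A[OF s_A[OF \<alpha>]] unfolding C_iff by auto
          moreover have "?s (?m (?s \<alpha>)) = \<alpha>"
            using sm[OF s_A[OF \<alpha>]] ss[OF \<alpha>] mm[OF \<alpha>] by simp
          ultimately show ?thesis by (metis UnI2 image_eqI)
        qed simp
      qed
    qed (auto simp: C_iff s_A)
    moreover have "C \<inter> ?s ` C = {}"
    proof -
      have False if "\<beta> \<in> C" "?s \<beta> \<in> C" for \<beta>
      proof -
        have \<beta>: "\<beta> \<in> A" using that C_iff by blast
        have s: "?s (?s \<beta>) = ?m \<beta>" "?s (?m \<beta>) = ?m (?s \<beta>)" "?s (?m (?s \<beta>)) = \<beta>"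
          using ss[OF \<beta>] sm[OF \<beta>] sm[OF s_A[OF \<beta>]] mm[OF \<beta>] by simp_all
        \<comment> \<open>Each of \<beta> and \<open>?s \<beta>\<close> is in \<open>B\<close>
          itself or after a half turn; every one of the four combinations exhibits a member of
          \<open>B\<close> whose quarter turn is again in \<open>B\<close>.\<close>
        then show False
          using that quarter[of \<beta>] quarter[of "?m \<beta>"] quarter[of "?s \<beta>"] quarter[of "?m (?s \<beta>)"]
          unfolding C_iff by auto
      qed
      then show ?thesis by blast
    qed
    moreover have "inj_on ?s C"
    proof (rule inj_onI)
      fix \<alpha> \<beta> assume C: "\<alpha> \<in> C" "\<beta> \<in> C" and eq: "?s \<alpha> = ?s \<beta>"
      then have A: "\<alpha> \<in> A" "\<beta> \<in> A" using C_iff by auto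
      from eq have "?m \<alpha> = ?m \<beta>" using ss[OF A(1)] ss[OF A(2)] by metis
      then show "\<alpha> = \<beta>" using mm[OF A(1)] mm[OF A(2)] by metis
    qed
    ultimately have card_A: "card A = 2 * card C" by (rule card_union_image)
    have m_quad: "?m (mod_act M \<gamma>) = mod_act (- M) \<gamma>" if "quad M" for M
    proof -
      have "- matI ** M = - M" by (cases M rule: mat2_cases) (simp add: mats)
      then show ?thesis using mod_act_mult[OF det(2) _ \<gamma>, of M] that by (simp add: quad_def)
    qed
    have "card A = (if has_nontrivial_torsion ?H then 2 else 4) * card B"
      using stab(2)
    proof (elim disjE)
      assume I: "- matI \<in> ?H"
      have "?m \<alpha> = \<alpha>" if elem: "\<alpha> \<in> B" for \<alpha>
      proof -
        obtain M where M: "quad M" "\<alpha> = mod_act M \<gamma>" using elem unfolding B_def T by blast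
        have "M ** (- matI) = - M" by (cases M rule: mat2_cases) (simp add: mats)
        then have "mod_act (- M) \<gamma> = mod_act M \<gamma>"
          using mod_act_mult[OF _ det(2) \<gamma>, of M] M(1) I by (simp add: quad_def mod_stab_iff)
        then show ?thesis using m_quad M by simp
      qed
      then have "C = B" unfolding C_def by auto
      then show ?thesis using card_A torsion_if[of ?H] I by simp
    next
      assume U: "matU \<in> ?H"
      have "?m \<alpha> \<in> B" if elem: "\<alpha> \<in> B" for \<alpha>
      proof -
        obtain M where M: "quad M" "\<alpha> = mod_act M \<gamma>" "curve_length \<alpha> = n"
          using elem unfolding B_def T by blast
        \<comment> \<open>The roots give curves of length \<ell>(\<gamma>), smaller than n.\<close>
        have "M \<notin> {mat 1, matS}"
          using M n curve_length_S[OF \<gamma>] mod_act_one[OF \<gamma>] by auto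
        then have "quad (- (M ** matU)) \<or> quad (- (M ** matU ** matU))"
          using quad_half_turn_U[OF M(1)] by blast
        then obtain h where h: "h \<in> ?H" "quad (- (M ** h))"
          using U mod_stab_mult[OF \<gamma> U U] by (metis matrix_mul_assoc)
        have "mod_act (- (M ** h)) \<gamma> = mod_act (- M ** h) \<gamma>"
          by (cases M rule: mat2_cases; cases h rule: mat2_cases) (simp add: algebra_simps)
        also have "\<dots> = mod_act (- M) \<gamma>"
        proof -
          have "det (- M) = 1" using M(1) by (cases M rule: mat2_cases) (simp add: quad_mat2)
          then show ?thesis using mod_act_mult[of "- M" h \<gamma>] h(1) \<gamma> by (simp add: mod_stab_iff)
        qed
        also have "\<dots> = ?m \<alpha>" using m_quad M by simp
        finally have "?m \<alpha> \<in> ?T" using h(2) unfolding T by blast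
        then show ?thesis using m_A elem B_A by (auto simp: A_def B_def)
      qed
      then have "C = B" unfolding C_def by auto
      then show ?thesis using card_A torsion_if[of ?H] U by simp
    next
      assume L: "\<forall>h\<in>?H. \<exists>t. h = mat2 1 t 0 1"
      have "?m \<alpha> \<notin> B" if elem: "\<alpha> \<in> B" for \<alpha>
      proof
        assume "?m \<alpha> \<in> B"
        then obtain M M' where M: "quad M" "\<alpha> = mod_act M \<gamma>" "quad M'" "?m \<alpha> = mod_act M' \<gamma>"
          using elem unfolding B_def T by blast
        have "det (- M) = 1" using M(1) by (cases M rule: mat2_cases) (simp add: quad_mat2)
        then obtain h where "h \<in> ?H" "M' = - M ** h"
          using mod_act_eq_stab[OF \<gamma>, of "- M" M'] M m_quad[OF M(1)] by (auto simp: quad_def)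
        then obtain t where "M' = - M ** mat2 1 t 0 1" using L by metis
        \<comment> \<open>The first column of \<open>M'\<close> is the negative of that of
          \<open>M\<close>. Both are nonnegative, so the column vanishes, contrary to determinant
          1.\<close>
        then show False
          using M(1,3) by (cases M rule: mat2_cases) (auto simp: quad_mat2)
      qed
      then have "B \<inter> ?m ` B = {}" by blast
      moreover have "inj_on ?m B"
        by (rule inj_on_inverseI[of _ ?m]) (use mm B_A in blast)
      ultimately have "card C = 2 * card B"
        using card_union_image[OF C_def] by blast
      moreover have "\<not> has_nontrivial_torsion ?H"
        using no_torsion_if[of ?H] L by blast
      ultimately show ?thesis using card_A by simp
    qed
    then show "card {\<alpha> \<in> mod_orbit \<gamma>. curve_length \<alpha> = n} =
        (if has_nontrivial_torsion ?H then 2 else 4) * card {\<alpha> \<in> ?T. curve_length \<alpha> = n}"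
      by (simp only: A_def B_def)
  qed
  with rotate show ?thesis by blast
qed

end
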